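(* Let $A$ and $B$ be Banach algebras. Then the projective tensor product $A\widehat{\otimes}B$ is $\Delta$-weak character amenable if and only if both $A$ and $B$ are $\Delta$-weak character amenable.
   Context: For a Banach algebra $A$, $\Delta(A)$ denotes the set of all nonzero characters (nonzero multiplicative linear functionals) on $A$. For $f\in A^*$ and $a\in A$, the functional $f.a\in A^*$ is defined by $(f.a)(b)=f(ab)$ for $b\in A$. For $\varphi\in\Delta(A)\cup\{0\}$, $A$ is called $\Delta$-weak $\varphi$-amenable if there exists $m\in A^{**}$ such that (1) $m(\varphi)=0$; and (2) $m(\psi.a)=\psi(a)$ for all $a\in A$ and all $\psi\in\Delta(A)\setminus\{\varphi\}$. $A$ is called $\Delta$-weak character amenable if it is $\Delta$-weak $\varphi$-amenable for every $\varphi\in\Delta(A)\cup\{0\}$. $A\widehat{\otimes}B$ is the projective tensor product of $A$ and $B$, a Banach algebra with product determined by $(a\otimes b)(a'\otimes b')=aa'\otimes bb'$.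
   Formalization: The direction from A⊗̂B to A and B is stated only when Δ(A) and Δ(B) are both empty or both nonempty; otherwise it fails, e.g. for A = ℂ with zero product and B = C¹[0,1], where A⊗̂B has no characters but B is not Δ-weak character amenable. *)

theory Defs
  imports "HOL-Analysis.Analysis"
begin

section \<open>Complex Banach algebras\<close>

class complex_algebra = real_algebra +
  fixes scaleC :: "complex \<Rightarrow> 'a \<Rightarrow> 'a" (infixr "*\<^sub>C" 75)
  assumes scaleC_add_right: "c *\<^sub>C (x + y) = c *\<^sub>C x + c *\<^sub>C y"
    and scaleC_add_left: "(c + d) *\<^sub>C x = c *\<^sub>C x + d *\<^sub>C x"
    and scaleC_scaleC: "c *\<^sub>C (d *\<^sub>C x) = (c * d) *\<^sub>C x"
    and scaleR_scaleC: "r *\<^sub>R x = complex_of_real r *\<^sub>C x"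
    and mult_scaleC_left: "(c *\<^sub>C x) * y = c *\<^sub>C (x * y)"
    and mult_scaleC_right: "x * (c *\<^sub>C y) = c *\<^sub>C (x * y)"

class complex_banach_algebra = complex_algebra + real_normed_algebra + banach +
  assumes norm_scaleC: "norm (c *\<^sub>C x) = cmod c * norm x"

lemma scaleC_one [simp]: "1 *\<^sub>C x = x"
  by (metis scaleR_scaleC of_real_1 scaleR_one)

lemma scaleC_zero_left [simp]: "0 *\<^sub>C x = 0"
  using scaleC_add_left[of 0 0 x] by simp

lemma scaleC_zero_right [simp]: "c *\<^sub>C 0 = 0"
  using scaleC_add_right[of c 0 0] by simp

lemma scaleC_minus_one: "(-1) *\<^sub>C x = - x"
  by (metis scaleR_scaleC of_real_minus of_real_1 scaleR_minus1_left)

lemma scaleC_minus_right: "c *\<^sub>C (- x) = - (c *\<^sub>C x)"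
  by (metis scaleC_add_right scaleC_zero_right add.right_inverse minus_unique)

lemma scaleC_diff_right: "c *\<^sub>C (x - y) = c *\<^sub>C x - c *\<^sub>C y"
  by (metis scaleC_add_right scaleC_minus_right diff_conv_add_uminus)

section \<open>Characters and $\Delta$-weak character amenability\<close>

definition complex_linear :: "('a::complex_algebra \<Rightarrow> complex) \<Rightarrow> bool"
  where "complex_linear f \<longleftrightarrow>
    (\<forall>x y. f (x + y) = f x + f y) \<and> (\<forall>c x. f (c *\<^sub>C x) = c * f x)"

definition dual :: "('a::complex_banach_algebra \<Rightarrow> complex) set"
  where "dual = {f. complex_linear f \<and> (\<exists>K. \<forall>x. cmod (f x) \<le> K * norm x)}"

text \<open>Functionals on the dual are represented by functions on \<^typ>\<open>'a \<Rightarrow> complex\<close> whose values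
  outside the dual are irrelevant. For a bounded functional, \<^const>\<open>onorm\<close> is its norm as an
  element of the dual space.\<close>

definition bidual :: "(('a::complex_banach_algebra \<Rightarrow> complex) \<Rightarrow> complex) set"
  where "bidual = {m.
    (\<forall>f\<in>dual. \<forall>g\<in>dual. m (\<lambda>x. f x + g x) = m f + m g) \<and>
    (\<forall>c. \<forall>f\<in>dual. m (\<lambda>x. c * f x) = c * m f) \<and>
    (\<exists>K. \<forall>f\<in>dual. cmod (m f) \<le> K * onorm f)}"

definition dual_action :: "('a::complex_banach_algebra \<Rightarrow> complex) \<Rightarrow> 'a \<Rightarrow> 'a \<Rightarrow> complex"
    (infixl "\<lhd>" 70)
  where "(f \<lhd> a) = (\<lambda>b. f (a * b))"

text \<open>Boundedness of characters is not part of the definition: it is automatic, see below.\<close>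

definition characters :: "('a::complex_banach_algebra \<Rightarrow> complex) set"
  where "characters = {\<phi>. complex_linear \<phi> \<and> (\<forall>x y. \<phi> (x * y) = \<phi> x * \<phi> y) \<and> \<phi> \<noteq> (\<lambda>_. 0)}"

definition Delta_weak_amenable :: "('a::complex_banach_algebra \<Rightarrow> complex) \<Rightarrow> bool"
  where "Delta_weak_amenable \<phi> \<longleftrightarrow>
    (\<exists>m\<in>bidual. m \<phi> = 0 \<and> (\<forall>a. \<forall>\<psi>\<in>characters - {\<phi>}. m (\<psi> \<lhd> a) = \<psi> a))"

definition Delta_weak_character_amenable :: "'a::complex_banach_algebra itself \<Rightarrow> bool"
  where "Delta_weak_character_amenable _ \<longleftrightarrow>
    (\<forall>\<phi>\<in>characters \<union> {\<lambda>_. 0}. Delta_weak_amenable (\<phi> :: 'a \<Rightarrow> complex))"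

lemma characters_contractive:
  assumes "\<phi> \<in> characters"
  shows "cmod (\<phi> x) \<le> norm x"
proof (rule ccontr)
  assume less: "\<not> cmod (\<phi> x) \<le> norm x"
  have add: "\<phi> (u + v) = \<phi> u + \<phi> v" and scale: "\<phi> (c *\<^sub>C u) = c * \<phi> u"
    and mult: "\<phi> (u * v) = \<phi> u * \<phi> v" for u v c
    using assms by (auto simp: characters_def complex_linear_def)
  have nz: "\<phi> x \<noteq> 0" using less norm_ge_zero[of x] by force
  define a where "a = inverse (\<phi> x) *\<^sub>C x"
  have a1: "\<phi> a = 1" using nz by (simp add: a_def scale)
  have na: "norm a < 1" using less nz by (simp add: a_def norm_scaleC norm_inverse) (simp add: field_simps)
  define p where "p n = ((*) a ^^ n) a" for n
  have p0: "p 0 = a" and pS: "p (Suc n) = a * p n" for n by (simp_all add: p_def)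
  have np: "norm (p n) \<le> norm a ^ Suc n" for n
  proof (induction n)
    case (Suc n)
    have "norm (p (Suc n)) \<le> norm a * norm (p n)" by (simp add: pS norm_mult_ineq)
    also have "\<dots> \<le> norm a * norm a ^ Suc n" by (intro mult_left_mono Suc.IH) simp
    finally show ?case by simp
  qed (simp add: p0)
  have "summable (\<lambda>n. norm a * norm a ^ n)" by (intro summable_mult summable_geometric) (use na in simp)
  then have sm: "summable p"
    by (rule summable_comparison_test') (use np in simp)
  have "suminf p = a + (\<Sum>n. a * p n)"
    using suminf_split_head[OF sm] by (simp add: p0 pS)
  moreover have "(\<Sum>n. a * p n) = a * suminf p"
    by (rule bounded_linear.suminf[OF bounded_linear_mult_right sm, symmetric])
  ultimately have "\<phi> (suminf p) = \<phi> (a + a * suminf p)" by (metis (no_types))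
  then show False by (simp only: add mult a1) simp
qed

lemma characters_subset_dual: "characters \<subseteq> dual"
proof
  fix \<phi> :: "'a \<Rightarrow> complex" assume \<phi>: "\<phi> \<in> characters"
  then have "complex_linear \<phi>" "\<forall>x. cmod (\<phi> x) \<le> 1 * norm x"
    by (auto simp: characters_contractive characters_def)
  then show "\<phi> \<in> dual" unfolding dual_def by (intro CollectI conjI exI)
qed

section \<open>Completion of a seminormed complex algebra\<close>

class seminormed_complex_algebra = complex_algebra +
  fixes seminorm :: "'a \<Rightarrow> real"
  assumes seminorm_triangle: "seminorm (x + y) \<le> seminorm x + seminorm y"
    and seminorm_scaleC: "seminorm (c *\<^sub>C x) = cmod c * seminorm x"
    and seminorm_mult: "seminorm (x * y) \<le> seminorm x * seminorm y"

lemma seminorm_zero [simp]: "seminorm 0 = 0"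
  using seminorm_scaleC[of 0 0] by simp

lemma seminorm_minus [simp]: "seminorm (- x) = seminorm x"
  using seminorm_scaleC[of "-1" x] by (simp add: scaleC_minus_one)

lemma seminorm_nonneg [simp]: "0 \<le> seminorm x"
  using seminorm_triangle[of x "- x"] by simp

lemma seminorm_minus_commute: "seminorm (x - y) = seminorm (y - x)"
  using seminorm_minus[of "x - y"] by simp

lemma seminorm_diff_triangle: "seminorm (x - z) \<le> seminorm (x - y) + seminorm (y - z)"
  using seminorm_triangle[of "x - y" "y - z"] by simp

lemma seminorm_diff_le: "seminorm (x - y) \<le> seminorm x + seminorm y"
  using seminorm_triangle[of x "- y"] by simp

lemma seminorm_abs_diff: "\<bar>seminorm x - seminorm y\<bar> \<le> seminorm (x - y)"
  using seminorm_triangle[of "x - y" y] seminorm_triangle[of "y - x" x]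
    seminorm_minus_commute[of x y] by (simp add: abs_le_iff)

definition seminorm_Cauchy :: "(nat \<Rightarrow> 'a::seminormed_complex_algebra) \<Rightarrow> bool"
  where "seminorm_Cauchy X \<longleftrightarrow>
    (\<forall>e>0. \<exists>N. \<forall>m\<ge>N. \<forall>n\<ge>N. seminorm (X m - X n) < e)"

lemma seminorm_Cauchy_const: "seminorm_Cauchy (\<lambda>_. x)"
  by (auto simp: seminorm_Cauchy_def)

lemma seminorm_Cauchy_lipschitz:
  assumes "seminorm_Cauchy X" "seminorm_Cauchy Y" "K \<ge> 0" "L \<ge> 0"
    and "\<And>m n. seminorm (Z m - Z n) \<le> K * seminorm (X m - X n) + L * seminorm (Y m - Y n)"
  shows "seminorm_Cauchy Z"
  unfolding seminorm_Cauchy_def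
proof (intro allI impI)
  fix e :: real assume "e > 0"
  define d where "d = e / (K + L + 1)"
  have "d > 0" using \<open>e > 0\<close> assms(3,4) by (simp add: d_def)
  then obtain M N where M: "\<And>m n. m \<ge> M \<Longrightarrow> n \<ge> M \<Longrightarrow> seminorm (X m - X n) < d"
    and N: "\<And>m n. m \<ge> N \<Longrightarrow> n \<ge> N \<Longrightarrow> seminorm (Y m - Y n) < d"
    using assms(1,2) unfolding seminorm_Cauchy_def by metis
  have "seminorm (Z m - Z n) < e" if "m \<ge> max M N" "n \<ge> max M N" for m n
  proof -
    have "seminorm (Z m - Z n) \<le> K * seminorm (X m - X n) + L * seminorm (Y m - Y n)" by (rule assms)
    also have "\<dots> \<le> K * d + L * d"
      using M[of m n] N[of m n] that assms(3,4) by (intro add_mono mult_left_mono) auto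
    also have "\<dots> < (K + L + 1) * d" using \<open>d > 0\<close> by (simp add: algebra_simps)
    also have "\<dots> = e" using assms(3,4) by (simp add: d_def)
    finally show ?thesis .
  qed
  then show "\<exists>N. \<forall>m\<ge>N. \<forall>n\<ge>N. seminorm (Z m - Z n) < e" by blast
qed

lemma seminorm_Cauchy_add:
  assumes "seminorm_Cauchy X" "seminorm_Cauchy Y" shows "seminorm_Cauchy (\<lambda>n. X n + Y n)"
  by (rule seminorm_Cauchy_lipschitz[OF assms, of 1 1])
    (auto simp: add_diff_add intro: seminorm_triangle)

lemma seminorm_Cauchy_scaleC:
  assumes "seminorm_Cauchy X" shows "seminorm_Cauchy (\<lambda>n. c *\<^sub>C X n)"
  by (rule seminorm_Cauchy_lipschitz[OF assms assms, of "cmod c" 0])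
    (auto simp: scaleC_diff_right[symmetric] seminorm_scaleC)

lemma seminorm_Cauchy_norm:
  assumes "seminorm_Cauchy X" shows "Cauchy (\<lambda>n. seminorm (X n))"
proof (rule metric_CauchyI)
  fix e :: real assume "e > 0"
  then obtain N where "\<And>m n. m \<ge> N \<Longrightarrow> n \<ge> N \<Longrightarrow> seminorm (X m - X n) < e"
    using assms unfolding seminorm_Cauchy_def by metis
  then show "\<exists>M. \<forall>m\<ge>M. \<forall>n\<ge>M. dist (seminorm (X m)) (seminorm (X n)) < e"
    unfolding dist_real_def using seminorm_abs_diff le_less_trans by blast
qed

lemma seminorm_Cauchy_convergent:
  "seminorm_Cauchy X \<Longrightarrow> (\<lambda>n. seminorm (X n)) \<longlonglongrightarrow> lim (\<lambda>n. seminorm (X n))"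
  using seminorm_Cauchy_norm Cauchy_convergent_iff convergent_LIMSEQ_iff by blast

lemma seminorm_Cauchy_bounded:
  assumes "seminorm_Cauchy X" obtains K where "K \<ge> 0" "\<And>n. seminorm (X n) \<le> K"
proof -
  have "Bseq (\<lambda>n. seminorm (X n))"
    using seminorm_Cauchy_norm[OF assms] Cauchy_Bseq by blast
  then obtain K where "K > 0" "\<And>n. norm (seminorm (X n)) \<le> K" by (auto simp: Bseq_def)
  then show ?thesis by (intro that[of K]) auto
qed

lemma seminorm_mult_diff:
  assumes "seminorm x \<le> K" "seminorm y' \<le> L"
  shows "seminorm (x * y - x' * y') \<le> L * seminorm (x - x') + K * seminorm (y - y')"
proof -
  have "x * y - x' * y' = (x - x') * y' + x * (y - y')" by (simp add: algebra_simps)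
  then have "seminorm (x * y - x' * y') \<le> seminorm (x - x') * seminorm y' + seminorm x * seminorm (y - y')"
    using seminorm_triangle[of "(x - x') * y'" "x * (y - y')"]
      seminorm_mult[of "x - x'" y'] seminorm_mult[of x "y - y'"] by simp
  also have "\<dots> \<le> seminorm (x - x') * L + K * seminorm (y - y')"
    using assms by (intro add_mono mult_left_mono mult_right_mono) auto
  finally show ?thesis by (simp add: mult.commute)
qed

lemma seminorm_Cauchy_mult:
  assumes "seminorm_Cauchy X" "seminorm_Cauchy Y" shows "seminorm_Cauchy (\<lambda>n. X n * Y n)"
proof -
  obtain K where K: "K \<ge> 0" "\<And>n. seminorm (X n) \<le> K" using assms(1) seminorm_Cauchy_bounded by blast
  obtain L where L: "L \<ge> 0" "\<And>n. seminorm (Y n) \<le> L" using assms(2) seminorm_Cauchy_bounded by blast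
  show ?thesis
    by (rule seminorm_Cauchy_lipschitz[OF assms, of L K]) (use K L in \<open>auto intro: seminorm_mult_diff\<close>)
qed

definition completion_rel :: "(nat \<Rightarrow> 'a::seminormed_complex_algebra) \<Rightarrow> (nat \<Rightarrow> 'a) \<Rightarrow> bool"
  where "completion_rel X Y \<longleftrightarrow> seminorm_Cauchy X \<and> seminorm_Cauchy Y \<and>
    (\<lambda>n. seminorm (X n - Y n)) \<longlonglongrightarrow> 0"

lemma completion_rel_refl: "completion_rel X X \<longleftrightarrow> seminorm_Cauchy X"
  by (simp add: completion_rel_def)

lemma completion_relI:
  assumes "seminorm_Cauchy Z" "seminorm_Cauchy W" "completion_rel X Y" "completion_rel X' Y'"
    and "\<And>n. seminorm (Z n - W n) \<le> K * seminorm (X n - Y n) + L * seminorm (X' n - Y' n)"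
  shows "completion_rel Z W"
proof -
  have "(\<lambda>n. K * seminorm (X n - Y n) + L * seminorm (X' n - Y' n)) \<longlonglongrightarrow> K * 0 + L * 0"
    using assms(3,4) unfolding completion_rel_def by (intro tendsto_intros) auto
  then have lim: "(\<lambda>n. K * seminorm (X n - Y n) + L * seminorm (X' n - Y' n)) \<longlonglongrightarrow> 0"
    by simp
  have "(\<lambda>n. seminorm (Z n - W n)) \<longlonglongrightarrow> 0"
    by (rule tendsto_sandwich[OF _ _ tendsto_const lim]) (simp_all add: assms(5))
  with assms(1,2) show ?thesis by (simp add: completion_rel_def)
qed

lemma part_equivp_completion_rel: "part_equivp completion_rel"
proof (rule part_equivpI)
  show "\<exists>X. completion_rel X X" using completion_rel_refl seminorm_Cauchy_const by blast
  show "symp completion_rel"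
    by (rule sympI) (simp add: completion_rel_def seminorm_minus_commute)
  show "transp completion_rel"
  proof (rule transpI)
    fix X Y Z assume *: "completion_rel X Y" "completion_rel Y Z"
    show "completion_rel X Z"
      by (rule completion_relI[OF _ _ *, of _ _ 1 1])
        (use * in \<open>auto simp: completion_rel_def intro: seminorm_diff_triangle\<close>)
  qed
qed

text \<open>Cauchy sequences modulo sequences converging to $0$. No separate passage to the quotient
  by the null space of the seminorm is needed; for a norm this is the usual completion.\<close>

quotient_type (overloaded) 'a completion =
  "nat \<Rightarrow> 'a::seminormed_complex_algebra" / partial: completion_rel
  by (rule part_equivp_completion_rel)

instantiation completion :: (seminormed_complex_algebra) complex_algebra
begin

lift_definition zero_completion :: "'a completion" is "\<lambda>_. 0"
  by (simp add: completion_rel_refl seminorm_Cauchy_const)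

lift_definition plus_completion :: "'a completion \<Rightarrow> 'a completion \<Rightarrow> 'a completion"
  is "\<lambda>X Y n. X n + Y n"
proof -
  fix X Y X' Y' :: "nat \<Rightarrow> 'a"
  assume *: "completion_rel X Y" "completion_rel X' Y'"
  show "completion_rel (\<lambda>n. X n + X' n) (\<lambda>n. Y n + Y' n)"
    by (rule completion_relI[OF _ _ *, of _ _ 1 1])
      (use * in \<open>auto simp: completion_rel_def add_diff_add intro: seminorm_triangle seminorm_Cauchy_add\<close>)
qed

lift_definition scaleC_completion :: "complex \<Rightarrow> 'a completion \<Rightarrow> 'a completion"
  is "\<lambda>c X n. c *\<^sub>C X n"
proof -
  fix c :: complex and X Y :: "nat \<Rightarrow> 'a"
  assume *: "completion_rel X Y"
  show "completion_rel (\<lambda>n. c *\<^sub>C X n) (\<lambda>n. c *\<^sub>C Y n)"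
    by (rule completion_relI[OF _ _ * *, of _ _ "cmod c" 0])
      (use * in \<open>auto simp: completion_rel_def scaleC_diff_right[symmetric] seminorm_scaleC
          intro: seminorm_Cauchy_scaleC\<close>)
qed

lift_definition times_completion :: "'a completion \<Rightarrow> 'a completion \<Rightarrow> 'a completion"
  is "\<lambda>X Y n. X n * Y n"
proof -
  fix X Y X' Y' :: "nat \<Rightarrow> 'a"
  assume *: "completion_rel X Y" "completion_rel X' Y'"
  then have C: "seminorm_Cauchy X" "seminorm_Cauchy Y'" by (auto simp: completion_rel_def)
  obtain K where K: "\<And>n. seminorm (X n) \<le> K" using C(1) seminorm_Cauchy_bounded by blast
  obtain L where L: "\<And>n. seminorm (Y' n) \<le> L" using C(2) seminorm_Cauchy_bounded by blast
  show "completion_rel (\<lambda>n. X n * X' n) (\<lambda>n. Y n * Y' n)"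
    by (rule completion_relI[OF _ _ *, of _ _ L K])
      (use * K L in \<open>auto simp: completion_rel_def intro: seminorm_Cauchy_mult seminorm_mult_diff\<close>)
qed

definition "- (x :: 'a completion) = (-1) *\<^sub>C x"
definition "x - (y :: 'a completion) = x + - y"
definition "r *\<^sub>R (x :: 'a completion) = complex_of_real r *\<^sub>C x"

instance
proof
  fix x y z :: "'a completion" and c d :: complex and r s :: real
  note cau = seminorm_Cauchy_add seminorm_Cauchy_mult seminorm_Cauchy_scaleC seminorm_Cauchy_const
  show add_assoc: "x + y + z = x + (y + z)"
    by transfer (simp only: add.assoc completion_rel_refl, (intro cau; assumption)?)
  show "x + y = y + x" by transfer (simp add: add.commute completion_rel_refl seminorm_Cauchy_add)
  show "0 + x = x" by transfer (simp only: add_0_left completion_rel_refl, (intro cau; assumption)?)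
  show "- x + x = 0" unfolding uminus_completion_def
    by transfer (simp only: scaleC_minus_one add.left_inverse completion_rel_refl, (intro cau; assumption)?)
  show "x - y = x + - y" by (simp add: minus_completion_def)
  show "x * y * z = x * (y * z)" by transfer (simp only: mult.assoc completion_rel_refl, (intro cau; assumption)?)
  show "(x + y) * z = x * z + y * z" by transfer (simp only: distrib_left distrib_right completion_rel_refl, (intro cau; assumption)?)
  show "x * (y + z) = x * y + x * z" by transfer (simp only: distrib_left distrib_right completion_rel_refl, (intro cau; assumption)?)
  show cr: "c *\<^sub>C (x + y) = c *\<^sub>C x + c *\<^sub>C y" for c :: complex and x y :: "'a completion"
    by transfer (simp only: scaleC_add_right completion_rel_refl, (intro cau; assumption)?)
  show cl: "(c + d) *\<^sub>C x = c *\<^sub>C x + d *\<^sub>C x" for c d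
    by transfer (simp only: scaleC_add_left completion_rel_refl, (intro cau; assumption)?)
  show cc: "c *\<^sub>C (d *\<^sub>C x) = (c * d) *\<^sub>C x" for c d
    by transfer (simp only: scaleC_scaleC completion_rel_refl, (intro cau; assumption)?)
  have c1: "1 *\<^sub>C x = x" by transfer (simp only: scaleC_one completion_rel_refl, (intro cau; assumption)?)
  show "r *\<^sub>R x = complex_of_real r *\<^sub>C x" by (simp add: scaleR_completion_def)
  show ml: "(c *\<^sub>C x) * y = c *\<^sub>C (x * y)" for c
    by transfer (simp only: mult_scaleC_left completion_rel_refl, (intro cau; assumption)?)
  show mr: "x * (c *\<^sub>C y) = c *\<^sub>C (x * y)" for c
    by transfer (simp only: mult_scaleC_right completion_rel_refl, (intro cau; assumption)?)
  show "r *\<^sub>R (x + y) = r *\<^sub>R x + r *\<^sub>R y" "(r + s) *\<^sub>R x = r *\<^sub>R x + s *\<^sub>R x"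
    "r *\<^sub>R s *\<^sub>R x = (r * s) *\<^sub>R x" "1 *\<^sub>R x = x"
    "r *\<^sub>R x * y = r *\<^sub>R (x * y)" "x * r *\<^sub>R y = r *\<^sub>R (x * y)"
    by (simp_all add: scaleR_completion_def cr cl cc c1 ml mr)
qed

end

instantiation completion :: (seminormed_complex_algebra) real_normed_algebra
begin

lift_definition norm_completion :: "'a completion \<Rightarrow> real" is "\<lambda>X. lim (\<lambda>n. seminorm (X n))"
proof -
  fix X Y :: "nat \<Rightarrow> 'a" assume *: "completion_rel X Y"
  then have X: "(\<lambda>n. seminorm (X n)) \<longlonglongrightarrow> lim (\<lambda>n. seminorm (X n))"
    and XY: "(\<lambda>n. seminorm (X n - Y n)) \<longlonglongrightarrow> 0"
    by (simp_all add: completion_rel_def seminorm_Cauchy_convergent)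
  have "(\<lambda>n. seminorm (Y n) - seminorm (X n)) \<longlonglongrightarrow> 0"
    by (rule tendsto_rabs_zero_cancel, rule tendsto_sandwich[OF _ _ tendsto_const XY])
      (simp_all add: seminorm_abs_diff abs_minus_commute)
  from tendsto_add[OF this X] show "lim (\<lambda>n. seminorm (X n)) = lim (\<lambda>n. seminorm (Y n))"
    by (simp add: limI)
qed

definition "dist x (y :: 'a completion) = norm (x - y)"
definition "sgn (x :: 'a completion) = x /\<^sub>R norm x"
definition "(uniformity :: ('a completion \<times> 'a completion) filter) =
  (INF e\<in>{0<..}. principal {(x, y). dist x y < e})"
definition "open (U :: 'a completion set) \<longleftrightarrow>
  (\<forall>x\<in>U. eventually (\<lambda>(x', y). x' = x \<longrightarrow> y \<in> U) uniformity)"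

instance
proof
  fix x y :: "'a completion" and r :: real and U :: "'a completion set"
  show "dist x y = norm (x - y)" by (rule dist_completion_def)
  show "sgn x = x /\<^sub>R norm x" by (rule sgn_completion_def)
  show "(uniformity :: ('a completion \<times> 'a completion) filter) =
      (INF e\<in>{0<..}. principal {(x, y). dist x y < e})" by (rule uniformity_completion_def)
  show "open U \<longleftrightarrow> (\<forall>x\<in>U. eventually (\<lambda>(x', y). x' = x \<longrightarrow> y \<in> U) uniformity)"
    by (rule open_completion_def)
  show "norm x = 0 \<longleftrightarrow> x = 0"
  proof transfer
    fix X :: "nat \<Rightarrow> 'a" assume "completion_rel X X"
    then have X: "seminorm_Cauchy X" by (simp add: completion_rel_refl)
    then show "lim (\<lambda>n. seminorm (X n)) = 0 \<longleftrightarrow> completion_rel X (\<lambda>_. 0)"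
      using seminorm_Cauchy_convergent[OF X] limI
      by (auto simp: completion_rel_def seminorm_Cauchy_const)
  qed
  show "norm (x + y) \<le> norm x + norm y"
  proof transfer
    fix X Y :: "nat \<Rightarrow> 'a" assume "completion_rel X X" "completion_rel Y Y"
    then have *: "seminorm_Cauchy X" "seminorm_Cauchy Y" by (simp_all add: completion_rel_refl)
    show "lim (\<lambda>n. seminorm (X n + Y n)) \<le> lim (\<lambda>n. seminorm (X n)) + lim (\<lambda>n. seminorm (Y n))"
      by (rule LIMSEQ_le[OF seminorm_Cauchy_convergent[OF seminorm_Cauchy_add[OF *]]
            tendsto_add[OF *[THEN seminorm_Cauchy_convergent]]])
        (simp add: seminorm_triangle)
  qed
  show "norm (x * y) \<le> norm x * norm y"
  proof transfer
    fix X Y :: "nat \<Rightarrow> 'a" assume "completion_rel X X" "completion_rel Y Y"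
    then have *: "seminorm_Cauchy X" "seminorm_Cauchy Y" by (simp_all add: completion_rel_refl)
    show "lim (\<lambda>n. seminorm (X n * Y n)) \<le> lim (\<lambda>n. seminorm (X n)) * lim (\<lambda>n. seminorm (Y n))"
      by (rule LIMSEQ_le[OF seminorm_Cauchy_convergent[OF seminorm_Cauchy_mult[OF *]]
            tendsto_mult[OF *[THEN seminorm_Cauchy_convergent]]])
        (simp add: seminorm_mult)
  qed
  show "norm (r *\<^sub>R x) = \<bar>r\<bar> * norm x" unfolding scaleR_completion_def
  proof transfer
    fix X :: "nat \<Rightarrow> 'a" and r :: real assume "completion_rel X X"
    then have "seminorm_Cauchy X" by (simp add: completion_rel_refl)
    from tendsto_mult[OF tendsto_const seminorm_Cauchy_convergent[OF this], of "\<bar>r\<bar>"]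
    show "lim (\<lambda>n. seminorm (complex_of_real r *\<^sub>C X n)) = \<bar>r\<bar> * lim (\<lambda>n. seminorm (X n))"
      by (simp add: limI seminorm_scaleC)
  qed
qed

end

lift_definition to_completion :: "'a::seminormed_complex_algebra \<Rightarrow> 'a completion" is "\<lambda>x _. x"
  by (simp add: completion_rel_refl seminorm_Cauchy_const)

lemma norm_to_completion [simp]: "norm (to_completion x) = seminorm x"
  by transfer (simp add: limI)

lemma to_completion_add: "to_completion (x + y) = to_completion x + to_completion y"
  by transfer (simp add: completion_rel_refl seminorm_Cauchy_const)

lemma to_completion_mult: "to_completion (x * y) = to_completion x * to_completion y"
  by transfer (simp add: completion_rel_refl seminorm_Cauchy_const)

lemma to_completion_scaleC: "to_completion (c *\<^sub>C x) = c *\<^sub>C to_completion x"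
  by transfer (simp add: completion_rel_refl seminorm_Cauchy_const)

lemma to_completion_minus: "to_completion (- x) = - to_completion x"
  using to_completion_scaleC[of "-1" x] by (simp add: scaleC_minus_one)

lemma to_completion_diff: "to_completion (x - y) = to_completion x - to_completion y"
  using to_completion_add[of x "- y"] by (simp add: to_completion_minus)

lemma to_completion_tendsto:
  assumes X: "seminorm_Cauchy X"
  shows "(\<lambda>n. to_completion (X n)) \<longlonglongrightarrow> abs_completion X"
proof (rule metric_LIMSEQ_I)
  fix e :: real assume "e > 0"
  then obtain N where N: "\<And>m n. m \<ge> N \<Longrightarrow> n \<ge> N \<Longrightarrow> seminorm (X m - X n) < e / 2"
    using X half_gt_zero unfolding seminorm_Cauchy_def by metis
  have "dist (to_completion (X n)) (abs_completion X) < e" if "n \<ge> N" for n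
  proof -
    have C: "seminorm_Cauchy (\<lambda>m. X n + (-1) *\<^sub>C X m)"
      by (intro seminorm_Cauchy_add seminorm_Cauchy_scaleC seminorm_Cauchy_const X)
    have R: "completion_rel X X" "completion_rel (\<lambda>_. X n) (\<lambda>_. X n)"
        "completion_rel (\<lambda>m. (-1) *\<^sub>C X m) (\<lambda>m. (-1) *\<^sub>C X m)"
      using X by (simp_all add: completion_rel_refl seminorm_Cauchy_const seminorm_Cauchy_scaleC)
    have "to_completion (X n) - abs_completion X = abs_completion (\<lambda>m. X n + (-1) *\<^sub>C X m)"
      unfolding minus_completion_def uminus_completion_def
      by (simp only: to_completion.abs_eq scaleC_completion.abs_eq[OF R(1)] plus_completion.abs_eq[OF R(2,3)])
    then have "dist (to_completion (X n)) (abs_completion X) = lim (\<lambda>m. seminorm (X n - X m))"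
      using C by (simp add: dist_norm norm_completion.abs_eq completion_rel_refl scaleC_minus_one)
    also have "\<dots> \<le> e / 2"
    proof (rule LIMSEQ_le_const2)
      show "(\<lambda>m. seminorm (X n - X m)) \<longlonglongrightarrow> lim (\<lambda>m. seminorm (X n - X m))"
        using seminorm_Cauchy_convergent[OF C] by (simp add: scaleC_minus_one)
      show "\<exists>M. \<forall>m\<ge>M. seminorm (X n - X m) \<le> e / 2" using N that less_imp_le by blast
    qed
    finally show ?thesis using \<open>e > 0\<close> by simp
  qed
  then show "\<exists>N. \<forall>n\<ge>N. dist (to_completion (X n)) (abs_completion X) < e" by blast
qed

lemma to_completion_dense: "closure (range to_completion) = UNIV"
proof -
  have "x \<in> closure (range to_completion)" for x :: "'a completion"
  proof (induction x rule: completion.abs_induct)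
    case (1 X)
    then have "seminorm_Cauchy X" by (simp add: completion_rel_refl)
    from to_completion_tendsto[OF this] show ?case
      unfolding closure_sequential by (intro exI[of _ "\<lambda>n. to_completion (X n)"]) simp
  qed
  then show ?thesis by blast
qed

instance completion :: (seminormed_complex_algebra) complex_banach_algebra
proof
  fix Z :: "nat \<Rightarrow> 'a completion" assume Z: "Cauchy Z"
  have "\<exists>t. dist (to_completion t) (Z n) < inverse (real (Suc n))" for n
  proof -
    have "Z n \<in> closure (range to_completion)" by (simp add: to_completion_dense)
    then show ?thesis
      unfolding closure_approachable by (metis inverse_positive_iff_positive of_nat_0_less_iff rangeE zero_less_Suc)
  qed
  then obtain t where t: "\<And>n. dist (to_completion (t n)) (Z n) < inverse (real (Suc n))" by metis
  have tZ: "(\<lambda>n. dist (to_completion (t n)) (Z n)) \<longlonglongrightarrow> 0"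
    by (rule tendsto_sandwich[OF _ _ tendsto_const LIMSEQ_inverse_real_of_nat])
      (simp_all add: t less_imp_le del: of_nat_Suc)
  have "seminorm_Cauchy t"
    unfolding seminorm_Cauchy_def
  proof (intro allI impI)
    fix e :: real assume "e > 0"
    then have e3: "e / 3 > 0" by simp
    obtain M where M: "\<And>m n. m \<ge> M \<Longrightarrow> n \<ge> M \<Longrightarrow> dist (Z m) (Z n) < e / 3"
      using metric_CauchyD[OF Z e3] by blast
    obtain N where N: "\<And>n. n \<ge> N \<Longrightarrow> dist (to_completion (t n)) (Z n) < e / 3"
      using order_tendstoD(2)[OF tZ e3] by (auto simp: eventually_sequentially)
    have "seminorm (t m - t n) < e" if "m \<ge> max M N" "n \<ge> max M N" for m n
    proof -
      have "seminorm (t m - t n) = dist (to_completion (t m)) (to_completion (t n))"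
        by (simp add: dist_norm flip: to_completion_diff)
      also have "\<dots> \<le> dist (to_completion (t m)) (Z m) + dist (Z m) (Z n) + dist (to_completion (t n)) (Z n)"
        using dist_triangle[of "to_completion (t m)" "to_completion (t n)" "Z m"]
          dist_triangle[of "Z m" "to_completion (t n)" "Z n"] by (simp add: dist_commute)
      also have "\<dots> < e" using M[of m n] N[of m] N[of n] that by simp
      finally show ?thesis .
    qed
    then show "\<exists>N. \<forall>m\<ge>N. \<forall>n\<ge>N. seminorm (t m - t n) < e" by blast
  qed
  then have lim: "(\<lambda>n. to_completion (t n)) \<longlonglongrightarrow> abs_completion t" by (rule to_completion_tendsto)
  have "Z \<longlonglongrightarrow> abs_completion t" by (rule Lim_transform[OF lim]) (use tZ in \<open>simp add: dist_norm tendsto_norm_zero_iff norm_minus_commute\<close>)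
  then show "convergent Z" by (rule convergentI)
next
  fix c :: complex and x :: "'a completion"
  show "norm (c *\<^sub>C x) = cmod c * norm x"
  proof transfer
    fix X :: "nat \<Rightarrow> 'a" and c :: complex assume "completion_rel X X"
    then have "seminorm_Cauchy X" by (simp add: completion_rel_refl)
    from tendsto_mult[OF tendsto_const seminorm_Cauchy_convergent[OF this], of "cmod c"]
    show "lim (\<lambda>n. seminorm (c *\<^sub>C X n)) = cmod c * lim (\<lambda>n. seminorm (X n))"
      by (simp add: limI seminorm_scaleC)
  qed
qed

section \<open>Projective tensor product\<close>

text \<open>The algebraic tensor product over the complex numbers. A multiset of pairs represents
  $\sum a \otimes b$, where scalars are absorbed into the factors; the relation is the smallest
  congruence on the free commutative monoid over the pairs that makes the generators bilinear.\<close>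

inductive tensor_rel ::
    "('a::complex_algebra \<times> 'b::complex_algebra) multiset \<Rightarrow> ('a \<times> 'b) multiset \<Rightarrow> bool" where
  refl: "tensor_rel M M"
| sym: "tensor_rel M N \<Longrightarrow> tensor_rel N M"
| trans: "tensor_rel M N \<Longrightarrow> tensor_rel N P \<Longrightarrow> tensor_rel M P"
| plus: "tensor_rel M M' \<Longrightarrow> tensor_rel N N' \<Longrightarrow> tensor_rel (M + N) (M' + N')"
| zero: "tensor_rel {#(0, b)#} {#}"
| add_left: "tensor_rel {#(a + a', b)#} {#(a, b), (a', b)#}"
| add_right: "tensor_rel {#(a, b + b')#} {#(a, b), (a, b')#}"
| scale: "tensor_rel {#(c *\<^sub>C a, b)#} {#(a, c *\<^sub>C b)#}"

lemma tensor_rel_reflI: "M = N \<Longrightarrow> tensor_rel M N"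
  by (simp add: tensor_rel.refl)

lemma equivp_tensor_rel: "equivp tensor_rel"
  by (intro equivpI reflpI sympI transpI) (auto intro: tensor_rel.intros)

quotient_type (overloaded) ('a, 'b) tensor =
  "('a::complex_algebra \<times> 'b::complex_algebra) multiset" / tensor_rel
  by (rule equivp_tensor_rel)

lemma tensor_rel_sum:
  assumes "\<And>x. x \<in># M \<Longrightarrow> tensor_rel (f x) (g x)"
  shows "tensor_rel (\<Sum>x\<in>#M. f x) (\<Sum>x\<in>#M. g x)"
  using assms by (induction M) (auto intro: tensor_rel.intros)

lemma tensor_rel_image_left:
  assumes "tensor_rel M N" "\<And>x y. f (x + y) = f x + f y" "\<And>c x. f (c *\<^sub>C x) = c *\<^sub>C f x"
    and "\<And>x y. g (x + y) = g x + g y" "\<And>c x. g (c *\<^sub>C x) = c *\<^sub>C g x"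
  shows "tensor_rel (image_mset (map_prod f g) M) (image_mset (map_prod f g) N)"
  using assms(1)
proof induction
  case (zero b)
  have "f 0 = 0" using assms(3)[of 0 0] by simp
  then show ?case by (simp add: tensor_rel.zero)
qed (auto simp: assms(2-) intro: tensor_rel.intros)

definition multiset_times ::
    "('a::times \<times> 'b::times) multiset \<Rightarrow> ('a \<times> 'b) multiset \<Rightarrow> ('a \<times> 'b) multiset"
  where "multiset_times M N = (\<Sum>(a, b)\<in>#M. {#(a * a', b * b'). (a', b') \<in># N#})"

lemma multiset_times_left:
  "multiset_times {#} N = {#}"
  "multiset_times (add_mset x M) N = image_mset (map_prod ((*) (fst x)) ((*) (snd x))) N + multiset_times M N"
  "multiset_times (M + M') N = multiset_times M N + multiset_times M' N"
  by (simp_all add: multiset_times_def case_prod_unfold map_prod_def)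

lemma multiset_times_right:
  "multiset_times M {#} = {#}"
  "multiset_times M (add_mset y N) = image_mset (map_prod (\<lambda>a. a * fst y) (\<lambda>b. b * snd y)) M + multiset_times M N"
  "multiset_times M (N + N') = multiset_times M N + multiset_times M N'"
  by (induction M) (simp_all add: multiset_times_left map_prod_def case_prod_unfold ac_simps)

lemma multiset_times_assoc:
  "multiset_times (multiset_times M N) P =
    multiset_times M (multiset_times N (P :: ('a::semigroup_mult \<times> 'b::semigroup_mult) multiset))"
proof -
  have "multiset_times (image_mset (map_prod ((*) a) ((*) b)) N) P =
      image_mset (map_prod ((*) a) ((*) b)) (multiset_times N P)"
    for a :: 'a and b :: 'b
    by (induction N)
      (auto simp: multiset_times_left image_mset.compositionality o_def map_prod_def case_prod_unfold
        mult.assoc)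
  then show ?thesis by (induction M) (simp_all add: multiset_times_left)
qed

lemma tensor_rel_times_right:
  assumes "tensor_rel N N'" shows "tensor_rel (multiset_times M N) (multiset_times M N')"
proof (induction M)
  case (add x M)
  show ?case unfolding multiset_times_left
    by (intro tensor_rel.plus add.IH tensor_rel_image_left assms)
      (simp_all add: distrib_left mult_scaleC_right)
qed (simp add: multiset_times_left tensor_rel.refl)

lemma tensor_rel_times_left:
  assumes "tensor_rel M M'" shows "tensor_rel (multiset_times M N) (multiset_times M' N)"
proof (induction N)
  case (add x N)
  show ?case unfolding multiset_times_right
    by (intro tensor_rel.plus add.IH tensor_rel_image_left assms)
      (simp_all add: distrib_right mult_scaleC_left)
qed (simp add: multiset_times_right tensor_rel.refl)

instantiation tensor :: (complex_algebra, complex_algebra) complex_algebra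
begin

lift_definition zero_tensor :: "('a, 'b) tensor" is "{#}" .

lift_definition plus_tensor :: "('a, 'b) tensor \<Rightarrow> ('a, 'b) tensor \<Rightarrow> ('a, 'b) tensor"
  is "(+)" by (rule tensor_rel.plus)

lift_definition scaleC_tensor :: "complex \<Rightarrow> ('a, 'b) tensor \<Rightarrow> ('a, 'b) tensor"
  is "\<lambda>c. image_mset (map_prod ((*\<^sub>C) c) (\<lambda>b. b))"
  by (rule tensor_rel_image_left) (simp_all add: scaleC_add_right scaleC_scaleC mult.commute)

lift_definition times_tensor :: "('a, 'b) tensor \<Rightarrow> ('a, 'b) tensor \<Rightarrow> ('a, 'b) tensor"
  is multiset_times
  by (rule tensor_rel.trans[OF tensor_rel_times_left tensor_rel_times_right])

definition "- (x :: ('a, 'b) tensor) = (-1) *\<^sub>C x"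
definition "x - (y :: ('a, 'b) tensor) = x + - y"
definition "r *\<^sub>R (x :: ('a, 'b) tensor) = complex_of_real r *\<^sub>C x"

instance
proof
  fix x y z :: "('a, 'b) tensor" and r s :: real
  show "x + y + z = x + (y + z)" by transfer (simp add: add.assoc tensor_rel.refl)
  show "x + y = y + x" by transfer (simp add: add.commute tensor_rel.refl)
  show "0 + x = x" by transfer (simp add: tensor_rel.refl)
  show "x - y = x + - y" by (simp add: minus_tensor_def)
  show "x * y * z = x * (y * z)" by transfer (simp add: multiset_times_assoc tensor_rel.refl)
  show "(x + y) * z = x * z + y * z" by transfer (simp add: multiset_times_left tensor_rel.refl)
  show "x * (y + z) = x * y + x * z" by transfer (simp add: multiset_times_right tensor_rel.refl)
  show cr: "c *\<^sub>C (x + y) = c *\<^sub>C x + c *\<^sub>C y" for c and x y :: "('a, 'b) tensor"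
    by transfer (simp add: tensor_rel.refl)
  show cl: "(c + d) *\<^sub>C x = c *\<^sub>C x + d *\<^sub>C x" for c d
  proof transfer
    fix c d and M :: "('a \<times> 'b) multiset"
    show "tensor_rel (image_mset (map_prod ((*\<^sub>C) (c + d)) (\<lambda>b. b)) M)
      (image_mset (map_prod ((*\<^sub>C) c) (\<lambda>b. b)) M + image_mset (map_prod ((*\<^sub>C) d) (\<lambda>b. b)) M)"
    proof (induction M)
      case (add x M)
      obtain a b where x: "x = (a, b)" by fastforce
      from tensor_rel.plus[OF tensor_rel.add_left[of "c *\<^sub>C a" "d *\<^sub>C a" b] add.IH] show ?case
        by (simp add: x scaleC_add_left add_mset_commute)
    qed (simp add: tensor_rel.refl)
  qed
  show cc: "c *\<^sub>C (d *\<^sub>C x) = (c * d) *\<^sub>C x" for c d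
    by transfer (simp add: image_mset.compositionality o_def map_prod_def case_prod_unfold scaleC_scaleC tensor_rel.refl)
  have c1: "1 *\<^sub>C x = x" by transfer (simp add: map_prod_def tensor_rel.refl)
  have c0: "0 *\<^sub>C x = 0"
  proof transfer
    fix M :: "('a \<times> 'b) multiset"
    show "tensor_rel (image_mset (map_prod ((*\<^sub>C) 0) (\<lambda>b. b)) M) {#}"
    proof (induction M)
      case (add x M)
      from tensor_rel.plus[OF tensor_rel.zero[of "snd x"] add.IH] show ?case
        by (simp add: map_prod_def case_prod_unfold)
    qed (simp add: tensor_rel.refl)
  qed
  show "- x + x = 0" using cl[of "-1" 1] by (simp add: uminus_tensor_def c1 c0)
  show "r *\<^sub>R x = complex_of_real r *\<^sub>C x" by (simp add: scaleR_tensor_def)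
  show ml: "(c *\<^sub>C x) * y = c *\<^sub>C (x * y)" for c
  proof transfer
    fix c and M N :: "('a \<times> 'b) multiset"
    show "tensor_rel (multiset_times (image_mset (map_prod ((*\<^sub>C) c) (\<lambda>b. b)) M) N)
      (image_mset (map_prod ((*\<^sub>C) c) (\<lambda>b. b)) (multiset_times M N))"
      by (rule tensor_rel_reflI, induction M)
        (simp_all add: multiset_times_left image_mset.compositionality o_def map_prod_def
          case_prod_unfold mult_scaleC_left)
  qed
  show mr: "x * (c *\<^sub>C y) = c *\<^sub>C (x * y)" for c
  proof transfer
    fix c and M N :: "('a \<times> 'b) multiset"
    show "tensor_rel (multiset_times M (image_mset (map_prod ((*\<^sub>C) c) (\<lambda>b. b)) N))
      (image_mset (map_prod ((*\<^sub>C) c) (\<lambda>b. b)) (multiset_times M N))"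
      by (rule tensor_rel_reflI, induction M)
        (simp_all add: multiset_times_left image_mset.compositionality o_def map_prod_def
          case_prod_unfold mult_scaleC_right)
  qed
  show "r *\<^sub>R (x + y) = r *\<^sub>R x + r *\<^sub>R y" "(r + s) *\<^sub>R x = r *\<^sub>R x + s *\<^sub>R x"
    "r *\<^sub>R s *\<^sub>R x = (r * s) *\<^sub>R x" "1 *\<^sub>R x = x"
    "r *\<^sub>R x * y = r *\<^sub>R (x * y)" "x * r *\<^sub>R y = r *\<^sub>R (x * y)"
    by (simp_all add: scaleR_tensor_def cr cl cc c1 ml mr)
qed

end

text \<open>The projective seminorm: the infimum of $\sum \|a\| \|b\|$ over all representations.\<close>

definition representation_cost :: "('a::real_normed_vector \<times> 'b::real_normed_vector) multiset \<Rightarrow> real"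
  where "representation_cost M = (\<Sum>(a, b)\<in>#M. norm a * norm b)"

lemma representation_cost_simps [simp]:
  "representation_cost {#} = 0"
  "representation_cost (add_mset x M) = norm (fst x) * norm (snd x) + representation_cost M"
  "representation_cost (M + N) = representation_cost M + representation_cost N"
  by (simp_all add: representation_cost_def case_prod_unfold)

lemma representation_cost_nonneg [simp]: "0 \<le> representation_cost M"
  by (induction M) auto

instantiation tensor :: (complex_banach_algebra, complex_banach_algebra) seminormed_complex_algebra
begin

definition seminorm_tensor :: "('a, 'b) tensor \<Rightarrow> real"
  where "seminorm_tensor u = (INF M\<in>{M. abs_tensor M = u}. representation_cost M)"

lemma seminorm_tensor_le: "seminorm (abs_tensor M) \<le> representation_cost M"
  unfolding seminorm_tensor_def by (rule cINF_lower) (auto intro!: bdd_belowI2[of _ 0])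

lemma seminorm_tensor_approx:
  fixes u :: "('a, 'b) tensor" assumes "e > 0"
  obtains M where "abs_tensor M = u" "representation_cost M < seminorm u + e"
proof -
  have "\<exists>M. abs_tensor M = u" by (metis Quotient3_abs_rep Quotient3_tensor)
  then have "\<exists>M\<in>{M. abs_tensor M = u}. representation_cost M < seminorm u + e"
    using assms unfolding seminorm_tensor_def
    by (subst cINF_less_iff[symmetric]) (auto intro!: bdd_belowI2[of _ 0])
  then show ?thesis using that by blast
qed

lemma representation_cost_image:
  "representation_cost (image_mset (map_prod ((*\<^sub>C) c) (\<lambda>b. b)) M) =
    cmod c * representation_cost (M :: ('a \<times> 'b) multiset)"
  by (induction M) (simp_all add: norm_scaleC distrib_left)

lemma representation_cost_times:
  "representation_cost (multiset_times M N) \<le>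
    representation_cost M * representation_cost (N :: ('a \<times> 'b) multiset)"
proof (induction M)
  case (add x M)
  have "representation_cost (image_mset (map_prod ((*) (fst x)) ((*) (snd x))) N) \<le>
      norm (fst x) * norm (snd x) * representation_cost N"
  proof (induction N)
    case (add y N)
    have "norm (fst x * fst y) * norm (snd x * snd y) \<le>
        (norm (fst x) * norm (fst y)) * (norm (snd x) * norm (snd y))"
      by (intro mult_mono norm_mult_ineq) auto
    with add.IH show ?case by (simp add: algebra_simps)
  qed simp
  with add.IH show ?case by (simp add: multiset_times_left distrib_right)
qed (simp add: multiset_times_left)

instance
proof
  fix x y :: "('a, 'b) tensor" and c :: complex
  show "seminorm (x + y) \<le> seminorm x + seminorm y"
  proof (rule field_le_epsilon)
    fix e :: real assume "e > 0"
    then obtain M N where M: "abs_tensor M = x" "representation_cost M < seminorm x + e / 2"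
      and N: "abs_tensor N = y" "representation_cost N < seminorm y + e / 2"
      by (metis seminorm_tensor_approx half_gt_zero)
    have "seminorm (x + y) \<le> representation_cost (M + N)"
      using seminorm_tensor_le[of "M + N"] by (simp add: plus_tensor.abs_eq flip: M(1) N(1))
    then show "seminorm (x + y) \<le> seminorm x + seminorm y + e" using M N by simp
  qed
  have le: "seminorm (c *\<^sub>C x) \<le> cmod c * seminorm x" for c and x :: "('a, 'b) tensor"
  proof (rule field_le_epsilon)
    fix e :: real assume "e > 0"
    define d where "d = e / (cmod c + 1)"
    have "d > 0" using \<open>e > 0\<close> unfolding d_def by (intro divide_pos_pos add_nonneg_pos) auto
    then obtain M where M: "abs_tensor M = x" "representation_cost M < seminorm x + d"
      by (metis seminorm_tensor_approx)
    have "seminorm (c *\<^sub>C x) \<le> cmod c * representation_cost M"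
      using seminorm_tensor_le[of "image_mset (map_prod ((*\<^sub>C) c) (\<lambda>b. b)) M"]
      by (simp add: scaleC_tensor.abs_eq representation_cost_image flip: M(1))
    also have "\<dots> \<le> cmod c * (seminorm x + d)" using M by (intro mult_left_mono) auto
    also have "\<dots> \<le> cmod c * seminorm x + (cmod c + 1) * d"
      using \<open>d > 0\<close> by (simp add: algebra_simps)
    also have "(cmod c + 1) * d = e"
    proof -
      have "cmod c + 1 \<noteq> 0" using norm_ge_zero[of c] by linarith
      then show ?thesis by (simp add: d_def)
    qed
    finally show "seminorm (c *\<^sub>C x) \<le> cmod c * seminorm x + e" .
  qed
  show "seminorm (c *\<^sub>C x) = cmod c * seminorm x"
  proof (cases "c = 0")
    case True
    have "seminorm (0 :: ('a, 'b) tensor) \<ge> 0"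
      unfolding seminorm_tensor_def
      by (rule cINF_greatest) (auto simp: zero_tensor_def)
    with le[of 0 x] True show ?thesis by simp
  next
    case False
    have "seminorm x \<le> cmod (inverse c) * seminorm (c *\<^sub>C x)"
      using le[of "inverse c" "c *\<^sub>C x"] False by (simp add: scaleC_scaleC)
    then have "cmod c * seminorm x \<le> seminorm (c *\<^sub>C x)"
      using False by (simp add: norm_inverse) (simp add: field_simps)
    with le[of c x] show ?thesis by simp
  qed
  show "seminorm (x * y) \<le> seminorm x * seminorm y"
  proof (rule tendsto_le[OF trivial_limit_at_right_real])
    show "((\<lambda>e. (seminorm x + e) * (seminorm y + e)) \<longlongrightarrow> seminorm x * seminorm y) (at_right 0)"
      by (auto intro!: tendsto_eq_intros)
    show "\<forall>\<^sub>F e in at_right 0. seminorm (x * y) \<le> (seminorm x + e) * (seminorm y + e)"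
    proof (rule eventually_at_right_less[THEN eventually_mono])
      fix e :: real assume "0 < e"
      then obtain M N where M: "abs_tensor M = x" "representation_cost M < seminorm x + e"
        and N: "abs_tensor N = y" "representation_cost N < seminorm y + e"
        by (metis seminorm_tensor_approx)
      have "seminorm (x * y) \<le> representation_cost (multiset_times M N)"
        using seminorm_tensor_le[of "multiset_times M N"] by (simp add: times_tensor.abs_eq flip: M(1) N(1))
      also have "\<dots> \<le> representation_cost M * representation_cost N" by (rule representation_cost_times)
      also have "\<dots> \<le> (seminorm x + e) * (seminorm y + e)"
      proof (intro mult_mono)
        show "0 \<le> seminorm x + e" using M(2) representation_cost_nonneg[of M] by linarith
      qed (use M(2) N(2) in auto)
      finally show "seminorm (x * y) \<le> (seminorm x + e) * (seminorm y + e)" .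
    qed
  qed (rule tendsto_const)
qed

end

type_synonym ('a, 'b) projective_tensor = "('a, 'b) tensor completion"

definition tensor_elem :: "'a::complex_banach_algebra \<Rightarrow> 'b::complex_banach_algebra \<Rightarrow> ('a, 'b) projective_tensor"
    (infixl "\<otimes>" 75)
  where "a \<otimes> b = to_completion (abs_tensor {#(a, b)#})"

lemma tensor_elem_mult: "(a \<otimes> b) * (a' \<otimes> b') = (a * a') \<otimes> (b * b')"
  by (simp add: tensor_elem_def times_tensor.abs_eq multiset_times_def flip: to_completion_mult)

lemma tensor_elem_bilinear:
  "(a + a') \<otimes> b = a \<otimes> b + a' \<otimes> b" "a \<otimes> (b + b') = a \<otimes> b + a \<otimes> b'"
  "(c *\<^sub>C a) \<otimes> b = c *\<^sub>C (a \<otimes> b)" "a \<otimes> (c *\<^sub>C b) = c *\<^sub>C (a \<otimes> b)"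
proof -
  have "abs_tensor {#(a + a', b)#} = abs_tensor ({#(a, b)#} + {#(a', b)#})"
    "abs_tensor {#(a, b + b')#} = abs_tensor ({#(a, b)#} + {#(a, b')#})"
    using tensor_rel.add_left[of a a' b] tensor_rel.add_right[of a b b']
    by (simp_all add: tensor.abs_eq_iff add_mset_commute)
  then show "(a + a') \<otimes> b = a \<otimes> b + a' \<otimes> b" "a \<otimes> (b + b') = a \<otimes> b + a \<otimes> b'"
    by (simp_all only: tensor_elem_def plus_tensor.abs_eq[symmetric] to_completion_add)
  show "(c *\<^sub>C a) \<otimes> b = c *\<^sub>C (a \<otimes> b)"
    by (simp add: tensor_elem_def scaleC_tensor.abs_eq flip: to_completion_scaleC)
  moreover have "(c *\<^sub>C a) \<otimes> b = a \<otimes> (c *\<^sub>C b)"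
    using tensor_rel.scale[of c a b] by (simp add: tensor_elem_def tensor.abs_eq_iff[symmetric])
  ultimately show "a \<otimes> (c *\<^sub>C b) = c *\<^sub>C (a \<otimes> b)" by simp
qed

lemma norm_tensor_elem_le: "norm (a \<otimes> b) \<le> norm a * norm b"
  using seminorm_tensor_le[of "{#(a, b)#}"] by (simp add: tensor_elem_def)

lemma to_completion_abs_tensor: "to_completion (abs_tensor M) = (\<Sum>(a, b)\<in>#M. a \<otimes> b)"
proof (induction M)
  case empty
  show ?case using to_completion_scaleC[of 0 "abs_tensor {#}"] by (simp add: zero_tensor_def[symmetric])
next
  case (add x M)
  have "abs_tensor (add_mset x M) = abs_tensor {#x#} + abs_tensor M"
    by (simp add: plus_tensor.abs_eq)
  with add.IH show ?case by (cases x) (simp add: to_completion_add tensor_elem_def)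
qed

lemma tensor_sums_dense: "closure (range (\<lambda>M. \<Sum>(a, b)\<in>#M. a \<otimes> b)) = UNIV"
proof -
  have "range abs_tensor = UNIV" by (metis Quotient3_abs_rep Quotient3_tensor surjI)
  then have "range (\<lambda>M. to_completion (abs_tensor M)) = range (to_completion :: ('a, 'b) tensor \<Rightarrow> _)"
    by (metis image_image)
  then show ?thesis
    using to_completion_dense by (simp add: to_completion_abs_tensor)
qed

end

theory Submission
  imports Defs
begin

text \<open>Since \<open>\<psi> \<lhd> a = \<psi> a \<cdot> \<psi>\<close> for a character \<open>\<psi>\<close>, being \<open>\<Delta>\<close>-weak \<open>\<phi>\<close>-amenable means that some
  functional in the bidual vanishes at \<open>\<phi>\<close> and equals 1 at all other characters. The characters
  of the projective tensor product are exactly the products \<open>\<phi> \<otimes> \<psi>\<close> of characters; the factors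
  of \<open>\<Phi>\<close> are \<open>a \<mapsto> \<Phi> (a a\<^sub>0 \<otimes> b\<^sub>0) / \<Phi> (a\<^sub>0 \<otimes> b\<^sub>0)\<close> and its analogue in \<open>b\<close>. If \<open>m\<^sub>0\<close>, \<open>n\<^sub>0\<close> are 1
  on all characters of the factors, and \<open>m\<close>, \<open>n\<close> are 0 at \<open>\<phi>\<close>, \<open>\<psi>\<close> and 1 at the other ones, then
  \<open>m\<^sub>0 \<otimes> n\<^sub>0 - (m\<^sub>0 - m) \<otimes> (n\<^sub>0 - n)\<close> is 0 at \<open>\<phi> \<otimes> \<psi>\<close> and 1 at the other characters. Conversely, a
  functional on the dual of the product restricts to one on the dual of a factor along
  \<open>f \<mapsto> f \<otimes> \<psi>\<close>, for any fixed character \<open>\<psi>\<close> of the other factor.\<close>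

section \<open>The dual and the bidual\<close>

lemma complex_linear_add: "complex_linear f \<Longrightarrow> f (x + y) = f x + f y"
  and complex_linear_scaleC: "complex_linear f \<Longrightarrow> f (c *\<^sub>C x) = c * f x"
  by (simp_all add: complex_linear_def)

lemma complex_linear_zero: "complex_linear f \<Longrightarrow> f 0 = 0"
  using complex_linear_scaleC[of f 0 0] by simp

lemma complex_linear_diff: "complex_linear f \<Longrightarrow> f (x - y) = f x - f y"
  using complex_linear_add[of f "x - y" y] by simp

lemma complex_linear_sum_mset: "complex_linear f \<Longrightarrow> f (\<Sum>x\<in>#M. g x) = (\<Sum>x\<in>#M. f (g x))"
  by (induction M) (simp_all add: complex_linear_zero[of f] complex_linear_add[of f])

lemma dualI:
  assumes "complex_linear f" "\<And>x. cmod (f x) \<le> K * norm x" shows "f \<in> dual"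
  using assms unfolding dual_def by blast

lemma dual_complex_linear: "f \<in> dual \<Longrightarrow> complex_linear f"
  by (simp add: dual_def)

text \<open>Complex linearity yields real linearity through \<open>scaleR_scaleC\<close>, so the
  general theory of \<open>onorm\<close> applies to the dual.\<close>

lemma dual_bounded_linear: assumes "f \<in> dual" shows "bounded_linear f"
proof -
  obtain K where K: "\<And>x. cmod (f x) \<le> K * norm x" and lin: "complex_linear f"
    using assms by (auto simp: dual_def)
  show ?thesis
  proof (rule bounded_linear_intro)
    show "norm (f x) \<le> norm x * K" for x using K[of x] by (simp add: mult.commute)
  qed (use lin in \<open>simp_all add: complex_linear_def scaleR_scaleC scaleR_conv_of_real\<close>)
qed

lemma dual_bound: "f \<in> dual \<Longrightarrow> cmod (f x) \<le> onorm f * norm x"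
  by (intro onorm dual_bounded_linear)

lemma dual_onorm_nonneg: "f \<in> dual \<Longrightarrow> 0 \<le> onorm f"
  by (intro onorm_pos_le dual_bounded_linear)

lemma dual_add: assumes "f \<in> dual" "g \<in> dual" shows "(\<lambda>x. f x + g x) \<in> dual"
proof (rule dualI)
  show "complex_linear (\<lambda>x. f x + g x)"
    using assms[THEN dual_complex_linear] by (simp add: complex_linear_def algebra_simps)
  show "cmod (f x + g x) \<le> (onorm f + onorm g) * norm x" for x
    using norm_triangle_ineq[of "f x" "g x"] assms[THEN dual_bound, of x] by (simp add: algebra_simps)
qed

lemma dual_scale: assumes "f \<in> dual" shows "(\<lambda>x. c * f x) \<in> dual"
proof (rule dualI)
  show "complex_linear (\<lambda>x. c * f x)"
    using dual_complex_linear[OF assms] by (simp add: complex_linear_def algebra_simps)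
  show "cmod (c * f x) \<le> (cmod c * onorm f) * norm x" for x
    using mult_left_mono[OF dual_bound[OF assms, of x], of "cmod c"] by (simp add: norm_mult mult.assoc)
qed

lemma zero_in_dual: "(\<lambda>_. 0) \<in> dual"
  by (rule dualI[of _ 0]) (simp_all add: complex_linear_def)

lemma bidualI:
  assumes "\<And>f g. f \<in> dual \<Longrightarrow> g \<in> dual \<Longrightarrow> m (\<lambda>x. f x + g x) = m f + m g"
    and "\<And>c f. f \<in> dual \<Longrightarrow> m (\<lambda>x. c * f x) = c * m f"
    and "\<And>f. f \<in> dual \<Longrightarrow> cmod (m f) \<le> K * onorm f"
  shows "m \<in> bidual"
  using assms unfolding bidual_def by blast

lemma bidual_add: "m \<in> bidual \<Longrightarrow> f \<in> dual \<Longrightarrow> g \<in> dual \<Longrightarrow> m (\<lambda>x. f x + g x) = m f + m g"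
  and bidual_scale: "m \<in> bidual \<Longrightarrow> f \<in> dual \<Longrightarrow> m (\<lambda>x. c * f x) = c * m f"
  by (simp_all add: bidual_def)

lemma bidual_zero: "m \<in> bidual \<Longrightarrow> m (\<lambda>_. 0) = 0"
  using bidual_scale[of m "\<lambda>_. 0" 0] zero_in_dual by simp

text \<open>Inequalities are later multiplied by this constant, so it should be nonnegative;
  enlarging \<open>K\<close> to \<open>max K 0\<close> is harmless because \<open>onorm\<close> is
  nonnegative on the dual.\<close>

lemma bidual_bound:
  assumes "m \<in> bidual"
  obtains K where "K \<ge> 0" "\<And>f. f \<in> dual \<Longrightarrow> cmod (m f) \<le> K * onorm f"
proof -
  obtain K where K: "\<And>f. f \<in> dual \<Longrightarrow> cmod (m f) \<le> K * onorm f"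
    using assms unfolding bidual_def by blast
  show ?thesis
  proof (rule that[of "max K 0"])
    fix f :: "'a \<Rightarrow> complex" assume f: "f \<in> dual"
    have "K * onorm f \<le> max K 0 * onorm f" by (intro mult_right_mono dual_onorm_nonneg f) simp
    with K[OF f] show "cmod (m f) \<le> max K 0 * onorm f" by linarith
  qed simp
qed

lemma bidual_diff:
  assumes "m \<in> bidual" "n \<in> bidual" shows "(\<lambda>f. m f - n f) \<in> bidual"
proof -
  obtain K where K: "\<And>f. f \<in> dual \<Longrightarrow> cmod (m f) \<le> K * onorm f" using assms(1) bidual_bound by blast
  obtain L where L: "\<And>f. f \<in> dual \<Longrightarrow> cmod (n f) \<le> L * onorm f" using assms(2) bidual_bound by blast
  show ?thesis
  proof (rule bidualI)
    show "cmod (m f - n f) \<le> (K + L) * onorm f" if "f \<in> dual" for f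
      using norm_triangle_ineq4[of "m f" "n f"] K[OF that] L[OF that] by (simp add: algebra_simps)
  qed (simp_all add: bidual_add[OF assms(1)] bidual_add[OF assms(2)]
    bidual_scale[OF assms(1)] bidual_scale[OF assms(2)] algebra_simps)
qed

section \<open>Amenability in terms of values at characters\<close>

lemma characters_in_dual: "\<phi> \<in> characters \<Longrightarrow> \<phi> \<in> dual"
  using characters_subset_dual by blast

lemma character_mult: "\<phi> \<in> characters \<Longrightarrow> \<phi> (x * y) = \<phi> x * \<phi> y"
  by (simp add: characters_def)

lemma character_nonzero: assumes "\<phi> \<in> characters" obtains a where "\<phi> a \<noteq> 0"
  using assms unfolding characters_def by blast

lemma bidual_character_action:
  "m \<in> bidual \<Longrightarrow> \<psi> \<in> characters \<Longrightarrow> m (\<psi> \<lhd> a) = \<psi> a * m \<psi>"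
  by (simp add: dual_action_def character_mult[of \<psi>] bidual_scale[of m] characters_in_dual)

text \<open>The action condition reads \<open>\<psi> a * m \<psi> = \<psi> a\<close>, and an
  \<open>a\<close> with \<open>\<psi> a \<noteq> 0\<close> cancels it to
  \<open>m \<psi> = 1\<close>.\<close>

lemma Delta_weak_amenable_iff:
  "Delta_weak_amenable \<phi> \<longleftrightarrow> (\<exists>m\<in>bidual. m \<phi> = 0 \<and> (\<forall>\<psi>\<in>characters - {\<phi>}. m \<psi> = 1))"
proof -
  have "(\<forall>a. m (\<psi> \<lhd> a) = \<psi> a) \<longleftrightarrow> m \<psi> = 1" if "m \<in> bidual" "\<psi> \<in> characters" for m \<psi>
  proof -
    obtain a where "\<psi> a \<noteq> 0" using character_nonzero \<open>\<psi> \<in> characters\<close> by blast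
    then show ?thesis using that by (auto simp: bidual_character_action[of m \<psi>])
  qed
  then have "m \<phi> = 0 \<and> (\<forall>a. \<forall>\<psi>\<in>characters - {\<phi>}. m (\<psi> \<lhd> a) = \<psi> a) \<longleftrightarrow>
      m \<phi> = 0 \<and> (\<forall>\<psi>\<in>characters - {\<phi>}. m \<psi> = 1)" if "m \<in> bidual" for m
    using that by (metis DiffD1)
  then show ?thesis unfolding Delta_weak_amenable_def by (rule bex_cong[OF HOL.refl])
qed

text \<open>If \<open>M\<close> is a witness at \<open>J \<phi>\<close>, then \<open>M\<close>
  composed with \<open>J\<close> is one at \<open>\<phi>\<close>. Linearity and boundedness of
  \<open>J\<close> put the composite into the bidual; injectivity on characters keeps
  \<open>J \<psi>\<close> apart from \<open>J \<phi>\<close>.\<close>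

lemma Delta_weak_character_amenable_pullback:
  fixes J :: "('c::complex_banach_algebra \<Rightarrow> complex) \<Rightarrow> ('d::complex_banach_algebra \<Rightarrow> complex)"
  assumes am: "Delta_weak_character_amenable TYPE('d)"
    and J_dual: "\<And>f. f \<in> dual \<Longrightarrow> J f \<in> dual"
    and J_add: "\<And>f g. f \<in> dual \<Longrightarrow> g \<in> dual \<Longrightarrow> J (\<lambda>x. f x + g x) = (\<lambda>u. J f u + J g u)"
    and J_scale: "\<And>c f. f \<in> dual \<Longrightarrow> J (\<lambda>x. c * f x) = (\<lambda>u. c * J f u)"
    and J_onorm: "\<And>f. f \<in> dual \<Longrightarrow> onorm (J f) \<le> L * onorm f"
    and J_char: "\<And>\<phi>. \<phi> \<in> characters \<Longrightarrow> J \<phi> \<in> characters"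
    and J_inj: "inj_on J characters"
  shows "Delta_weak_character_amenable TYPE('c)"
  unfolding Delta_weak_character_amenable_def
proof
  fix \<phi> :: "'c \<Rightarrow> complex" assume \<phi>: "\<phi> \<in> characters \<union> {\<lambda>_. 0}"
  have J0: "J (\<lambda>_. 0) = (\<lambda>_. 0)" using J_scale[OF zero_in_dual, of 0] by simp
  have "J \<phi> \<in> characters \<union> {\<lambda>_. 0}" using \<phi> J_char J0 by auto
  then have "Delta_weak_amenable (J \<phi>)"
    by (rule am[unfolded Delta_weak_character_amenable_def, rule_format])
  then obtain M where M: "M \<in> bidual" "M (J \<phi>) = 0" "\<forall>\<Psi>\<in>characters - {J \<phi>}. M \<Psi> = 1"
    unfolding Delta_weak_amenable_iff by (elim bexE conjE)
  obtain K where K: "K \<ge> 0" "\<And>F. F \<in> dual \<Longrightarrow> cmod (M F) \<le> K * onorm F"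
    using bidual_bound[OF M(1)] by blast
  have "(\<lambda>f. M (J f)) \<in> bidual"
  proof (rule bidualI)
    fix f :: "'c \<Rightarrow> complex" assume f: "f \<in> dual"
    have "cmod (M (J f)) \<le> K * onorm (J f)" by (intro K J_dual f)
    also have "\<dots> \<le> K * (L * onorm f)" by (intro mult_left_mono J_onorm f K)
    finally show "cmod (M (J f)) \<le> (K * L) * onorm f" by (simp add: mult.assoc)
  qed (simp_all add: J_add J_scale bidual_add[OF M(1)] bidual_scale[OF M(1)] J_dual)
  moreover have "M (J \<psi>) = 1" if "\<psi> \<in> characters - {\<phi>}" for \<psi>
  proof -
    \<comment> \<open>Injectivity covers only characters. For \<open>\<phi> = 0\<close> the reason
      is instead that \<open>J \<phi> = 0\<close> while the character \<open>J \<psi>\<close> is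
      nonzero.\<close>
    have "J \<psi> \<noteq> J \<phi>"
    proof (cases "\<phi> \<in> characters")
      case True then show ?thesis using that J_inj by (auto dest: inj_onD)
    next
      case False
      then have "J \<phi> = (\<lambda>_. 0)" using \<phi> J0 by auto
      moreover have "J \<psi> \<in> characters" using that J_char by blast
      ultimately show ?thesis by (auto simp: characters_def)
    qed
    then show ?thesis using M(3) that J_char by blast
  qed
  ultimately show "Delta_weak_amenable \<phi>"
    unfolding Delta_weak_amenable_iff by (intro bexI[of _ "\<lambda>f. M (J f)"]) (simp_all add: M(2))
qed

section \<open>Functionals on the projective tensor product\<close>

text \<open>A chosen representative is used because an arbitrary \<open>L\<close> need not respect
  \<open>completion_rel\<close>. For bounded linear \<open>L\<close> the limit exists and does not
  depend on the choice.\<close>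

definition completion_ext ::
    "('a::seminormed_complex_algebra \<Rightarrow> complex) \<Rightarrow> 'a completion \<Rightarrow> complex"
  where "completion_ext L u = lim (\<lambda>n. L (rep_completion u n))"

context
  fixes L :: "'a::seminormed_complex_algebra \<Rightarrow> complex" and K :: real
  assumes lin: "complex_linear L" and bd: "\<And>x. cmod (L x) \<le> K * seminorm x"
begin

text \<open>\<open>L\<close> is Lipschitz, so it maps Cauchy sequences to Cauchy sequences and
  equivalent sequences to sequences with the same limit. Hence any representative computes the
  extension.\<close>

lemma completion_ext_tendsto:
  assumes X: "seminorm_Cauchy X"
  shows "(\<lambda>n. L (X n)) \<longlonglongrightarrow> completion_ext L (abs_completion X)"
proof -
  define Y where "Y = rep_completion (abs_completion X)"
  have YX: "completion_rel Y X"
    unfolding Y_def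
    by (rule Quotient3_rep_abs[OF Quotient3_completion]) (simp add: completion_rel_refl X)
  \<comment> \<open>The sign of \<open>K\<close> is not known, hence the absolute value.\<close>
  have diff: "cmod (L x - L y) \<le> \<bar>K\<bar> * seminorm (x - y)" for x y
  proof -
    have "cmod (L x - L y) \<le> K * seminorm (x - y)"
      using bd[of "x - y"] by (simp add: complex_linear_diff[OF lin])
    also have "\<dots> \<le> \<bar>K\<bar> * seminorm (x - y)" by (intro mult_right_mono) auto
    finally show ?thesis .
  qed
  have "Cauchy (\<lambda>n. L (X n))"
  proof (rule metric_CauchyI)
    fix e :: real assume "e > 0"
    then have "e / (\<bar>K\<bar> + 1) > 0" by (intro divide_pos_pos add_nonneg_pos) auto
    then obtain N where N: "\<And>m n. m \<ge> N \<Longrightarrow> n \<ge> N \<Longrightarrow> seminorm (X m - X n) < e / (\<bar>K\<bar> + 1)"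
      using X unfolding seminorm_Cauchy_def by blast
    have "dist (L (X m)) (L (X n)) < e" if "m \<ge> N" "n \<ge> N" for m n
    proof -
      have "dist (L (X m)) (L (X n)) \<le> \<bar>K\<bar> * seminorm (X m - X n)"
        unfolding dist_norm by (rule diff)
      also have "\<dots> \<le> (\<bar>K\<bar> + 1) * seminorm (X m - X n)" by (intro mult_right_mono) auto
      also have "\<dots> < e" using N[OF that] by (simp add: field_simps)
      finally show ?thesis .
    qed
    then show "\<exists>M. \<forall>m\<ge>M. \<forall>n\<ge>M. dist (L (X m)) (L (X n)) < e" by blast
  qed
  then obtain l where l: "(\<lambda>n. L (X n)) \<longlonglongrightarrow> l"
    using Cauchy_convergent_iff convergent_def by blast
  have "(\<lambda>n. \<bar>K\<bar> * seminorm (Y n - X n)) \<longlonglongrightarrow> \<bar>K\<bar> * 0"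
    using YX unfolding completion_rel_def by (intro tendsto_intros) simp
  then have "(\<lambda>n. \<bar>K\<bar> * seminorm (Y n - X n)) \<longlonglongrightarrow> 0" by simp
  then have "(\<lambda>n. L (Y n) - L (X n)) \<longlonglongrightarrow> 0"
    by (rule Lim_null_comparison[rotated]) (simp add: diff)
  from tendsto_add[OF this l] have "(\<lambda>n. L (Y n)) \<longlonglongrightarrow> l" by simp
  then have "completion_ext L (abs_completion X) = l"
    by (simp add: completion_ext_def limI flip: Y_def)
  with l show ?thesis by simp
qed

lemma completion_ext_to_completion: "completion_ext L (to_completion x) = L x"
  using LIMSEQ_unique[OF completion_ext_tendsto[OF seminorm_Cauchy_const] tendsto_const]
  by (simp add: to_completion.abs_eq)

text \<open>Both sides of each equation are limits of one and the same sequence of values of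
  \<open>L\<close>.\<close>

lemma complex_linear_completion_ext: "complex_linear (completion_ext L)"
  unfolding complex_linear_def
proof (intro conjI allI)
  fix x y :: "'a completion"
  show "completion_ext L (x + y) = completion_ext L x + completion_ext L y"
  proof (induction x rule: completion.abs_induct)
    case (1 X)
    then show ?case
    proof (induction y rule: completion.abs_induct)
      case (1 Y)
      then have *: "seminorm_Cauchy X" "seminorm_Cauchy Y" by (simp_all add: completion_rel_refl)
      have "(\<lambda>n. L (X n + Y n)) \<longlonglongrightarrow> completion_ext L (abs_completion X + abs_completion Y)"
        unfolding plus_completion.abs_eq[OF 1(2,1)]
        by (rule completion_ext_tendsto) (intro seminorm_Cauchy_add *)
      moreover have "(\<lambda>n. L (X n + Y n)) \<longlonglongrightarrow>
          completion_ext L (abs_completion X) + completion_ext L (abs_completion Y)"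
        unfolding complex_linear_add[OF lin] by (intro tendsto_add completion_ext_tendsto *)
      ultimately show ?case by (rule LIMSEQ_unique)
    qed
  qed
next
  fix c and x :: "'a completion"
  show "completion_ext L (c *\<^sub>C x) = c * completion_ext L x"
  proof (induction x rule: completion.abs_induct)
    case (1 X)
    then have *: "seminorm_Cauchy X" by (simp add: completion_rel_refl)
    have "(\<lambda>n. L (c *\<^sub>C X n)) \<longlonglongrightarrow> completion_ext L (c *\<^sub>C abs_completion X)"
      unfolding scaleC_completion.abs_eq[OF 1]
      by (rule completion_ext_tendsto) (intro seminorm_Cauchy_scaleC *)
    moreover have "(\<lambda>n. L (c *\<^sub>C X n)) \<longlonglongrightarrow> c * completion_ext L (abs_completion X)"
      unfolding complex_linear_scaleC[OF lin] by (intro tendsto_mult tendsto_const completion_ext_tendsto *)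
    ultimately show ?case by (rule LIMSEQ_unique)
  qed
qed

lemma completion_ext_bound: "cmod (completion_ext L u) \<le> K * norm u"
proof (induction u rule: completion.abs_induct)
  case (1 X)
  then have *: "seminorm_Cauchy X" by (simp add: completion_rel_refl)
  show ?case unfolding norm_completion.abs_eq[OF 1]
    by (rule LIMSEQ_le[OF tendsto_norm[OF completion_ext_tendsto[OF *]]
          tendsto_mult[OF tendsto_const seminorm_Cauchy_convergent[OF *]]]) (simp add: bd)
qed

end

section \<open>The functional \<open>f \<otimes> g\<close> on the projective tensor product\<close>

definition tensor_pairing ::
    "('a::complex_banach_algebra \<Rightarrow> complex) \<Rightarrow> ('b::complex_banach_algebra \<Rightarrow> complex) \<Rightarrow> ('a, 'b) tensor \<Rightarrow> complex"
  where "tensor_pairing f g t = (\<Sum>(a, b)\<in>#rep_tensor t. f a * g b)"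

definition tensor_functional ::
    "('a::complex_banach_algebra \<Rightarrow> complex) \<Rightarrow> ('b::complex_banach_algebra \<Rightarrow> complex) \<Rightarrow> ('a, 'b) projective_tensor \<Rightarrow> complex"
  where "tensor_functional f g = completion_ext (tensor_pairing f g)"

context
  fixes f :: "'a::complex_banach_algebra \<Rightarrow> complex" and g :: "'b::complex_banach_algebra \<Rightarrow> complex"
  assumes f: "f \<in> dual" and g: "g \<in> dual"
begin

text \<open>Independence of the representation: each rule generating \<open>tensor_rel\<close>
  preserves the sum, because \<open>f\<close> and \<open>g\<close> are linear.\<close>

lemma tensor_pairing_abs: "tensor_pairing f g (abs_tensor M) = (\<Sum>(a, b)\<in>#M. f a * g b)"
proof -
  note lf = dual_complex_linear[OF f] and lg = dual_complex_linear[OF g]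
  have "(\<Sum>(a, b)\<in>#M. f a * g b) = (\<Sum>(a, b)\<in>#N. f a * g b)" if "tensor_rel M N" for M N
    using that
    by induction (simp_all add: complex_linear_zero[OF lf] complex_linear_add[OF lf] complex_linear_add[OF lg]
        complex_linear_scaleC[OF lf] complex_linear_scaleC[OF lg] algebra_simps)
  moreover have "tensor_rel (rep_tensor (abs_tensor M)) M"
    by (rule Quotient3_rep_abs[OF Quotient3_tensor]) (rule tensor_rel.refl)
  ultimately show ?thesis unfolding tensor_pairing_def by blast
qed

lemma complex_linear_tensor_pairing: "complex_linear (tensor_pairing f g)"
  unfolding complex_linear_def
proof (intro conjI allI)
  fix x y :: "('a, 'b) tensor"
  show "tensor_pairing f g (x + y) = tensor_pairing f g x + tensor_pairing f g y"
    by (induction x rule: tensor.abs_induct, induction y rule: tensor.abs_induct)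
      (simp add: plus_tensor.abs_eq tensor_pairing_abs)
next
  fix c and x :: "('a, 'b) tensor"
  have "(\<Sum>(a, b)\<in>#image_mset (map_prod ((*\<^sub>C) c) (\<lambda>b. b)) M. f a * g b) = c * (\<Sum>(a, b)\<in>#M. f a * g b)" for M
    by (induction M) (auto simp: complex_linear_scaleC[OF dual_complex_linear[OF f]] algebra_simps)
  then show "tensor_pairing f g (c *\<^sub>C x) = c * tensor_pairing f g x"
    by (induction x rule: tensor.abs_induct) (simp only: scaleC_tensor.abs_eq tensor_pairing_abs)
qed

text \<open>Every representation of \<open>t\<close> bounds the value by \<open>K\<close> times its
  cost; the infimum over representations gives the seminorm.\<close>

lemma tensor_pairing_bound: "cmod (tensor_pairing f g t) \<le> onorm f * onorm g * seminorm t"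
proof -
  define K where "K = onorm f * onorm g"
  have K: "K \<ge> 0" using f g by (simp add: K_def dual_onorm_nonneg)
  have cost: "cmod (tensor_pairing f g (abs_tensor M)) \<le> K * representation_cost M" for M
    unfolding tensor_pairing_abs
  proof (induction M)
    case (add x M)
    have "cmod (f (fst x) * g (snd x)) \<le> (onorm f * norm (fst x)) * (onorm g * norm (snd x))"
      unfolding norm_mult by (intro mult_mono dual_bound f g mult_nonneg_nonneg dual_onorm_nonneg) auto
    also have "\<dots> = K * (norm (fst x) * norm (snd x))" by (simp add: K_def)
    finally have "cmod (f (fst x) * g (snd x)) \<le> K * (norm (fst x) * norm (snd x))" .
    with add.IH show ?case
      by (auto simp: case_prod_unfold distrib_left intro: order_trans[OF norm_triangle_ineq] add_mono)
  qed simp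
  show ?thesis unfolding K_def[symmetric]
  \<comment> \<open>Costs come within \<open>e\<close> of the seminorm. Letting \<open>e\<close>
    tend to 0 from the right avoids a division by \<open>K\<close>, which may be 0.\<close>
  proof (rule tendsto_le[OF trivial_limit_at_right_real])
    show "((\<lambda>e. K * (seminorm t + e)) \<longlongrightarrow> K * seminorm t) (at_right 0)"
      by (auto intro!: tendsto_eq_intros)
    show "\<forall>\<^sub>F e in at_right 0. cmod (tensor_pairing f g t) \<le> K * (seminorm t + e)"
    proof (rule eventually_at_right_less[THEN eventually_mono])
      fix e :: real assume "0 < e"
      then obtain M where M: "abs_tensor M = t" "representation_cost M < seminorm t + e"
        by (rule seminorm_tensor_approx)
      have "cmod (tensor_pairing f g t) \<le> K * representation_cost M" using cost[of M] M(1) by simp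
      also have "\<dots> \<le> K * (seminorm t + e)" using K M(2) by (intro mult_left_mono) auto
      finally show "cmod (tensor_pairing f g t) \<le> K * (seminorm t + e)" .
    qed
  qed (rule tendsto_const)
qed

lemmas tensor_pairing_extends = complex_linear_tensor_pairing tensor_pairing_bound

lemma tensor_functional_elem: "tensor_functional f g (a \<otimes> b) = f a * g b"
  unfolding tensor_functional_def tensor_elem_def
    completion_ext_to_completion[OF tensor_pairing_extends] tensor_pairing_abs by simp

lemma tensor_functional_dual: "tensor_functional f g \<in> dual"
  unfolding tensor_functional_def
  by (rule dualI[OF complex_linear_completion_ext[OF tensor_pairing_extends]
        completion_ext_bound[OF tensor_pairing_extends]])

lemma onorm_tensor_functional_le: "onorm (tensor_functional f g) \<le> onorm f * onorm g"
  unfolding tensor_functional_def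
  by (rule onorm_bound[OF _ completion_ext_bound[OF tensor_pairing_extends]])
    (simp add: f g dual_onorm_nonneg)

end

section \<open>Equality of functionals by density, and translates of functionals\<close>

text \<open>The set where \<open>F\<close> and \<open>G\<close> agree is closed and, by linearity,
  contains all finite sums of elementary tensors, which are dense.\<close>

lemma tensor_dual_eqI:
  fixes F G :: "('a::complex_banach_algebra, 'b::complex_banach_algebra) projective_tensor \<Rightarrow> complex"
  assumes F: "F \<in> dual" and G: "G \<in> dual" and eq: "\<And>a b. F (a \<otimes> b) = G (a \<otimes> b)"
  shows "F = G"
proof -
  have "F (\<Sum>(a, b)\<in>#M. a \<otimes> b) = G (\<Sum>(a, b)\<in>#M. a \<otimes> b)" for M
    by (simp add: complex_linear_sum_mset[OF dual_complex_linear[OF F]]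
        complex_linear_sum_mset[OF dual_complex_linear[OF G]] eq case_prod_unfold)
  then have "range (\<lambda>M. \<Sum>(a, b)\<in>#M. a \<otimes> b) \<subseteq> {u. F u = G u}" by blast
  moreover have "closed {u. F u = G u}"
    by (intro closed_Collect_eq linear_continuous_on dual_bounded_linear F G)
  ultimately have "closure (range (\<lambda>M. \<Sum>(a, b)\<in>#M. a \<otimes> b)) \<subseteq> {u. F u = G u}"
    by (rule closure_minimal)
  then show ?thesis unfolding tensor_sums_dense by auto
qed

text \<open>With one factor of a product held fixed, the value of \<open>F\<close> is a bounded
  functional of the other, so \<open>tensor_dual_eqI\<close> can test multiplicativity.\<close>

lemma dual_mult_left:
  assumes "F \<in> dual" shows "(\<lambda>x. F (y * x)) \<in> dual"
proof (rule dualI)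
  note lin = dual_complex_linear[OF assms]
  show "complex_linear (\<lambda>x. F (y * x))"
    by (simp add: complex_linear_def distrib_left mult_scaleC_right complex_linear_add[OF lin] complex_linear_scaleC[OF lin])
  show "cmod (F (y * x)) \<le> (onorm F * norm y) * norm x" for x
    using order_trans[OF dual_bound[OF assms] mult_left_mono[OF norm_mult_ineq dual_onorm_nonneg[OF assms]]]
    by (simp add: mult.assoc)
qed

lemma dual_mult_right:
  assumes "F \<in> dual" shows "(\<lambda>x. F (x * y)) \<in> dual"
proof (rule dualI)
  note lin = dual_complex_linear[OF assms]
  show "complex_linear (\<lambda>x. F (x * y))"
    by (simp add: complex_linear_def distrib_right mult_scaleC_left complex_linear_add[OF lin] complex_linear_scaleC[OF lin])
  show "cmod (F (x * y)) \<le> (onorm F * norm y) * norm x" for x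
    using order_trans[OF dual_bound[OF assms] mult_left_mono[OF norm_mult_ineq dual_onorm_nonneg[OF assms]]]
    by (simp add: mult_ac)
qed

section \<open>Characters of the projective tensor product\<close>

text \<open>Multiplicativity is evident on two elementary tensors. Density extends it first to an
  arbitrary right factor, then to an arbitrary left factor.\<close>

lemma tensor_functional_character:
  assumes \<phi>: "\<phi> \<in> characters" and \<psi>: "\<psi> \<in> characters"
  shows "tensor_functional \<phi> \<psi> \<in> characters"
proof -
  define F where "F = tensor_functional \<phi> \<psi>"
  have dual: "\<phi> \<in> dual" "\<psi> \<in> dual" using \<phi> \<psi> by (simp_all add: characters_in_dual)
  have F: "F \<in> dual" unfolding F_def by (rule tensor_functional_dual[OF dual])
  have elem: "F (a \<otimes> b) = \<phi> a * \<psi> b" for a b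
    unfolding F_def by (rule tensor_functional_elem[OF dual])
  have "(\<lambda>u. F ((a \<otimes> b) * u)) = (\<lambda>u. F (a \<otimes> b) * F u)" for a b
    by (rule tensor_dual_eqI[OF dual_mult_left[OF F] dual_scale[OF F]])
      (simp add: tensor_elem_mult elem character_mult[OF \<phi>] character_mult[OF \<psi>])
  then have mult_elem: "F ((a \<otimes> b) * u) = F u * F (a \<otimes> b)" for a b u
    by (simp add: fun_eq_iff mult.commute)
  have "(\<lambda>v. F (v * u)) = (\<lambda>v. F u * F v)" for u
    by (rule tensor_dual_eqI[OF dual_mult_right[OF F] dual_scale[OF F]]) (rule mult_elem)
  then have "F (v * u) = F v * F u" for u v by (simp add: fun_eq_iff mult.commute)
  moreover obtain a b where "\<phi> a \<noteq> 0" "\<psi> b \<noteq> 0" using character_nonzero \<phi> \<psi> by metis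
  then have "F (a \<otimes> b) \<noteq> 0" by (simp add: elem)
  then have "F \<noteq> (\<lambda>_. 0)" by auto
  ultimately show ?thesis using dual_complex_linear[OF F] unfolding characters_def F_def[symmetric] by blast
qed

text \<open>No unit is available for restricting \<open>\<Phi>\<close> to a factor, so an elementary
  tensor at which \<open>\<Phi>\<close> is nonzero takes its place. Since the values of
  \<open>\<Phi>\<close> commute, \<open>a\<^sub>0\<close> and \<open>b\<^sub>0\<close> may be moved
  to either side.\<close>

lemma tensor_character_factors:
  fixes \<Phi> :: "('a::complex_banach_algebra, 'b::complex_banach_algebra) projective_tensor \<Rightarrow> complex"
  assumes \<Phi>: "\<Phi> \<in> characters"
  obtains \<phi> \<psi> where "\<phi> \<in> characters" "\<psi> \<in> characters" "\<Phi> = tensor_functional \<phi> \<psi>"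
proof -
  note lin = dual_complex_linear[OF characters_in_dual[OF \<Phi>]]
  have "\<exists>a b. \<Phi> (a \<otimes> b) \<noteq> 0"
  proof (rule ccontr)
    assume "\<nexists>a b. \<Phi> (a \<otimes> b) \<noteq> 0"
    then have "\<Phi> = (\<lambda>_. 0)" by (intro tensor_dual_eqI characters_in_dual \<Phi> zero_in_dual) simp
    with \<Phi> show False by (simp add: characters_def)
  qed
  then obtain a\<^sub>0 b\<^sub>0 where nz: "\<Phi> (a\<^sub>0 \<otimes> b\<^sub>0) \<noteq> 0" by blast
  define c where "c = \<Phi> (a\<^sub>0 \<otimes> b\<^sub>0)"
  have c: "c \<noteq> 0" using nz by (simp add: c_def)
  have mult: "\<Phi> (a \<otimes> b) * \<Phi> (a' \<otimes> b') = \<Phi> ((a * a') \<otimes> (b * b'))" for a a' b b'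
    by (simp add: tensor_elem_mult flip: character_mult[OF \<Phi>])
  define \<phi> where "\<phi> a = \<Phi> ((a * a\<^sub>0) \<otimes> b\<^sub>0) / c" for a
  define \<psi> where "\<psi> b = \<Phi> (a\<^sub>0 \<otimes> (b * b\<^sub>0)) / c" for b
  have \<phi>': "\<phi> a = \<Phi> ((a\<^sub>0 * a) \<otimes> b\<^sub>0) / c" for a
  proof -
    \<comment> \<open>Both sides are the value of \<open>\<Phi>\<close> at \<open>(a\<^sub>0 * a *
      a\<^sub>0) \<otimes> (b\<^sub>0 * b\<^sub>0)\<close>.\<close>
    have "c * \<Phi> ((a * a\<^sub>0) \<otimes> b\<^sub>0) = \<Phi> ((a\<^sub>0 * a) \<otimes> b\<^sub>0) * c" by (simp add: c_def mult mult.assoc)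
    then show ?thesis using c by (simp add: \<phi>_def)
  qed
  have \<psi>': "\<psi> b = \<Phi> (a\<^sub>0 \<otimes> (b\<^sub>0 * b)) / c" for b
  proof -
    have "c * \<Phi> (a\<^sub>0 \<otimes> (b * b\<^sub>0)) = \<Phi> (a\<^sub>0 \<otimes> (b\<^sub>0 * b)) * c" by (simp add: c_def mult mult.assoc)
    then show ?thesis using c by (simp add: \<psi>_def)
  qed
  have \<phi>_mult: "\<phi> (a * a') = \<phi> a * \<phi> a'" for a a'
  proof -
    \<comment> \<open>Putting \<open>a\<^sub>0\<close> on the left for \<open>a\<close> and on the
      right for \<open>a'\<close> brings \<open>a\<close> and \<open>a'\<close> next to each other
      in the product.\<close>
    have "\<Phi> ((a\<^sub>0 * a) \<otimes> b\<^sub>0) * \<Phi> ((a' * a\<^sub>0) \<otimes> b\<^sub>0) = c * \<Phi> ((a * a' * a\<^sub>0) \<otimes> b\<^sub>0)"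
      by (simp add: c_def mult mult.assoc)
    then show ?thesis using c by (simp add: \<phi>'[of a] \<phi>_def[of a'] \<phi>_def[of "a * a'"] field_simps)
  qed
  have \<psi>_mult: "\<psi> (b * b') = \<psi> b * \<psi> b'" for b b'
  proof -
    have "\<Phi> (a\<^sub>0 \<otimes> (b\<^sub>0 * b)) * \<Phi> (a\<^sub>0 \<otimes> (b' * b\<^sub>0)) = c * \<Phi> (a\<^sub>0 \<otimes> (b * b' * b\<^sub>0))"
      by (simp add: c_def mult mult.assoc)
    then show ?thesis using c by (simp add: \<psi>'[of b] \<psi>_def[of b'] \<psi>_def[of "b * b'"] field_simps)
  qed
  have prod: "\<Phi> (a \<otimes> b) = \<phi> a * \<psi> b" for a b
  proof -
    \<comment> \<open>Both sides are the value of \<open>\<Phi>\<close> at \<open>(a\<^sub>0 * a *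
      a\<^sub>0) \<otimes> (b\<^sub>0 * b * b\<^sub>0)\<close>.\<close>
    have "c * \<Phi> (a \<otimes> b) * c = \<Phi> ((a\<^sub>0 * a) \<otimes> b\<^sub>0) * \<Phi> (a\<^sub>0 \<otimes> (b * b\<^sub>0))"
      by (simp add: c_def mult mult.assoc)
    then show ?thesis using c by (simp add: \<phi>' \<psi>_def field_simps)
  qed
  have "complex_linear \<phi>" "complex_linear \<psi>"
    by (simp_all add: complex_linear_def \<phi>_def \<psi>_def distrib_right mult_scaleC_left tensor_elem_bilinear
        complex_linear_add[OF lin] complex_linear_scaleC[OF lin] add_divide_distrib)
  moreover have "\<phi> a\<^sub>0 \<noteq> 0" "\<psi> b\<^sub>0 \<noteq> 0" using nz by (auto simp: prod)
  ultimately have chars: "\<phi> \<in> characters" "\<psi> \<in> characters"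
    using \<phi>_mult \<psi>_mult by (auto simp: characters_def)
  have "\<Phi> = tensor_functional \<phi> \<psi>"
    by (intro tensor_dual_eqI characters_in_dual \<Phi> tensor_functional_dual chars)
      (simp add: prod tensor_functional_elem characters_in_dual chars)
  with chars show ?thesis by (rule that)
qed

section \<open>Tensor products of bidual elements\<close>

text \<open>Iterated evaluation of the bilinear form given by \<open>F\<close>, with
  \<open>n\<close> applied in the second variable first. On functionals \<open>f \<otimes> g\<close>
  the result is the product \<open>m f * n g\<close>.\<close>

definition bidual_tensor ::
    "(('a::complex_banach_algebra \<Rightarrow> complex) \<Rightarrow> complex) \<Rightarrow> (('b::complex_banach_algebra \<Rightarrow> complex) \<Rightarrow> complex) \<Rightarrow>
      (('a, 'b) projective_tensor \<Rightarrow> complex) \<Rightarrow> complex"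
  where "bidual_tensor m n F = m (\<lambda>a. n (\<lambda>b. F (a \<otimes> b)))"

lemma dual_tensor_elem_bound:
  assumes F: "F \<in> dual" shows "cmod (F (a \<otimes> b)) \<le> (onorm F * norm a) * norm b"
  using order_trans[OF dual_bound[OF F] mult_left_mono[OF norm_tensor_elem_le dual_onorm_nonneg[OF F]]]
  by (simp add: mult.assoc)

lemma dual_tensor_elem_right:
  assumes F: "F \<in> dual" shows "(\<lambda>b. F (a \<otimes> b)) \<in> dual"
  by (rule dualI[OF _ dual_tensor_elem_bound[OF F]])
    (simp add: complex_linear_def tensor_elem_bilinear complex_linear_add[OF dual_complex_linear[OF F]]
      complex_linear_scaleC[OF dual_complex_linear[OF F]])

context
  fixes m :: "('a::complex_banach_algebra \<Rightarrow> complex) \<Rightarrow> complex"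
    and n :: "('b::complex_banach_algebra \<Rightarrow> complex) \<Rightarrow> complex"
  assumes m: "m \<in> bidual" and n: "n \<in> bidual"
begin

lemma bidual_tensor_elem:
  assumes "f \<in> dual" "g \<in> dual" shows "bidual_tensor m n (tensor_functional f g) = m f * n g"
proof -
  have "bidual_tensor m n (tensor_functional f g) = m (\<lambda>a. n g * f a)"
    unfolding bidual_tensor_def tensor_functional_elem[OF assms] bidual_scale[OF n assms(2)]
    by (simp only: mult.commute)
  then show ?thesis by (simp add: bidual_scale[OF m assms(1)])
qed

text \<open>The slice of \<open>F\<close> at \<open>a\<close> has norm at most
  \<open>onorm F * norm a\<close>. Applying \<open>n\<close> therefore leaves a functional of
  \<open>a\<close> with norm at most \<open>L * onorm F\<close>, and \<open>m\<close> contributes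
  the factor \<open>K\<close>.\<close>

lemma bidual_tensor_bidual: "bidual_tensor m n \<in> bidual"
proof -
  obtain K where K: "K \<ge> 0" "\<And>f. f \<in> dual \<Longrightarrow> cmod (m f) \<le> K * onorm f" using bidual_bound[OF m] by blast
  obtain L where L: "L \<ge> 0" "\<And>g. g \<in> dual \<Longrightarrow> cmod (n g) \<le> L * onorm g" using bidual_bound[OF n] by blast
  have slice_bound: "cmod (n (\<lambda>b. F (a \<otimes> b))) \<le> (L * onorm F) * norm a" if F: "F \<in> dual"
    for F :: "('a, 'b) projective_tensor \<Rightarrow> complex" and a
  proof -
    have "onorm (\<lambda>b. F (a \<otimes> b)) \<le> onorm F * norm a"
      by (intro onorm_bound dual_tensor_elem_bound F mult_nonneg_nonneg dual_onorm_nonneg norm_ge_zero)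
    from order_trans[OF L(2)[OF dual_tensor_elem_right[OF F]] mult_left_mono[OF this L(1)]]
    show ?thesis by (simp add: mult.assoc)
  qed
  have slice_dual: "(\<lambda>a. n (\<lambda>b. F (a \<otimes> b))) \<in> dual" if F: "F \<in> dual"
    for F :: "('a, 'b) projective_tensor \<Rightarrow> complex"
    by (rule dualI[OF _ slice_bound[OF F]])
      (simp add: complex_linear_def tensor_elem_bilinear complex_linear_add[OF dual_complex_linear[OF F]]
        complex_linear_scaleC[OF dual_complex_linear[OF F]]
        bidual_add[OF n] bidual_scale[OF n] dual_tensor_elem_right[OF F])
  show ?thesis
  proof (rule bidualI)
    fix F :: "('a, 'b) projective_tensor \<Rightarrow> complex" assume F: "F \<in> dual"
    have "onorm (\<lambda>a. n (\<lambda>b. F (a \<otimes> b))) \<le> L * onorm F"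
      by (intro onorm_bound slice_bound F mult_nonneg_nonneg L(1) dual_onorm_nonneg)
    from order_trans[OF K(2)[OF slice_dual[OF F]] mult_left_mono[OF this K(1)]]
    show "cmod (bidual_tensor m n F) \<le> (K * L) * onorm F" by (simp add: bidual_tensor_def mult.assoc)
    show "bidual_tensor m n (\<lambda>x. c * F x) = c * bidual_tensor m n F" for c
      unfolding bidual_tensor_def
      by (simp add: bidual_scale[OF n dual_tensor_elem_right[OF F]] bidual_scale[OF m slice_dual[OF F]])
    fix G :: "('a, 'b) projective_tensor \<Rightarrow> complex" assume G: "G \<in> dual"
    show "bidual_tensor m n (\<lambda>x. F x + G x) = bidual_tensor m n F + bidual_tensor m n G"
      unfolding bidual_tensor_def
      by (simp add: bidual_add[OF n dual_tensor_elem_right[OF F] dual_tensor_elem_right[OF G]]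
          bidual_add[OF m slice_dual[OF F] slice_dual[OF G]])
  qed
qed

end

section \<open>Amenability of the projective tensor product\<close>

lemma Delta_weak_character_amenable_obtain:
  assumes "Delta_weak_character_amenable TYPE('a::complex_banach_algebra)"
    and "\<phi> \<in> characters \<union> {\<lambda>_. 0 :: complex}"
  obtains m where "m \<in> bidual" "m \<phi> = 0" "\<And>\<psi> :: 'a \<Rightarrow> complex. \<psi> \<in> characters \<Longrightarrow> \<psi> \<noteq> \<phi> \<Longrightarrow> m \<psi> = 1"
proof -
  have "Delta_weak_amenable \<phi>"
    by (rule assms(1)[unfolded Delta_weak_character_amenable_def, rule_format, OF assms(2)])
  then obtain m where m: "m \<in> bidual" "m \<phi> = 0" "\<forall>\<psi>\<in>characters - {\<phi>}. m \<psi> = 1"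
    unfolding Delta_weak_amenable_iff by (elim bexE conjE)
  show ?thesis by (rule that[OF m(1,2)]) (simp add: m(3))
qed

lemma Delta_weak_character_amenable_tensor:
  assumes A: "Delta_weak_character_amenable TYPE('a::complex_banach_algebra)"
    and B: "Delta_weak_character_amenable TYPE('b::complex_banach_algebra)"
  shows "Delta_weak_character_amenable TYPE(('a, 'b) projective_tensor)"
  unfolding Delta_weak_character_amenable_def
proof
  fix \<Phi> :: "('a, 'b) projective_tensor \<Rightarrow> complex" assume "\<Phi> \<in> characters \<union> {\<lambda>_. 0}"
  \<comment> \<open>Amenability at the zero functional, which is not a character, gives an element
    equal to 1 on all characters.\<close>
  obtain m\<^sub>0 where m0: "m\<^sub>0 \<in> bidual" and m0_char: "\<And>\<psi> :: 'a \<Rightarrow> complex. \<psi> \<in> characters \<Longrightarrow> m\<^sub>0 \<psi> = 1"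
    by (rule Delta_weak_character_amenable_obtain[OF A, of "\<lambda>_. 0"]) (auto simp: characters_def)
  obtain n\<^sub>0 where n0: "n\<^sub>0 \<in> bidual" and n0_char: "\<And>\<psi> :: 'b \<Rightarrow> complex. \<psi> \<in> characters \<Longrightarrow> n\<^sub>0 \<psi> = 1"
    by (rule Delta_weak_character_amenable_obtain[OF B, of "\<lambda>_. 0"]) (auto simp: characters_def)
  have val: "bidual_tensor m n (tensor_functional \<alpha> \<beta>) = m \<alpha> * n \<beta>"
    if "m \<in> bidual" "n \<in> bidual" "\<alpha> \<in> characters" "\<beta> \<in> characters" for m n and \<alpha> :: "'a \<Rightarrow> complex" and \<beta> :: "'b \<Rightarrow> complex"
    using that by (intro bidual_tensor_elem characters_in_dual)
  consider "\<Phi> = (\<lambda>_. 0)" | "\<Phi> \<in> characters" using \<open>\<Phi> \<in> _\<close> by blast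
  then show "Delta_weak_amenable \<Phi>"
  proof cases
    case 1
    show ?thesis unfolding Delta_weak_amenable_iff
    proof (intro bexI conjI ballI)
      show M: "bidual_tensor m\<^sub>0 n\<^sub>0 \<in> bidual" by (rule bidual_tensor_bidual[OF m0 n0])
      show "bidual_tensor m\<^sub>0 n\<^sub>0 \<Phi> = 0" unfolding 1 by (rule bidual_zero[OF M])
      fix \<Psi> :: "('a, 'b) projective_tensor \<Rightarrow> complex" assume "\<Psi> \<in> characters - {\<Phi>}"
      then obtain \<alpha> \<beta> where "\<alpha> \<in> characters" "\<beta> \<in> characters" "\<Psi> = tensor_functional \<alpha> \<beta>"
        using tensor_character_factors by blast
      then show "bidual_tensor m\<^sub>0 n\<^sub>0 \<Psi> = 1" by (simp add: val m0 n0 m0_char n0_char)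
    qed
  next
    case 2
    then obtain \<phi> \<psi> where \<phi>: "\<phi> \<in> characters" and \<psi>: "\<psi> \<in> characters" and \<Phi>: "\<Phi> = tensor_functional \<phi> \<psi>"
      by (rule tensor_character_factors)
    obtain m where m: "m \<in> bidual" "m \<phi> = 0" "\<And>\<alpha>. \<alpha> \<in> characters \<Longrightarrow> \<alpha> \<noteq> \<phi> \<Longrightarrow> m \<alpha> = 1"
      by (rule Delta_weak_character_amenable_obtain[OF A, of \<phi>]) (use \<phi> in auto)
    obtain n where n: "n \<in> bidual" "n \<psi> = 0" "\<And>\<beta>. \<beta> \<in> characters \<Longrightarrow> \<beta> \<noteq> \<psi> \<Longrightarrow> n \<beta> = 1"
      by (rule Delta_weak_character_amenable_obtain[OF B, of \<psi>]) (use \<psi> in auto)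
    note m' = bidual_diff[OF m0 m(1)] and n' = bidual_diff[OF n0 n(1)]
    \<comment> \<open>\<open>bidual_tensor m n\<close> alone would vanish also at
      \<open>\<phi> \<otimes> \<beta>\<close> with \<open>\<beta> \<noteq> \<psi>\<close>. In
      \<open>M\<close> the subtracted term is 1 at \<open>\<phi> \<otimes> \<psi>\<close> and 0 as
      soon as one factor differs.\<close>
    define M where "M F = bidual_tensor m\<^sub>0 n\<^sub>0 F - bidual_tensor (\<lambda>f. m\<^sub>0 f - m f) (\<lambda>g. n\<^sub>0 g - n g) F" for F
    have M_val: "M (tensor_functional \<alpha> \<beta>) = 1 - (1 - m \<alpha>) * (1 - n \<beta>)"
      if "\<alpha> \<in> characters" "\<beta> \<in> characters" for \<alpha> \<beta>
      using that by (simp add: M_def val m0 n0 m' n' m0_char n0_char)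
    show ?thesis unfolding Delta_weak_amenable_iff
    proof (intro bexI conjI ballI)
      show "M \<in> bidual"
        unfolding M_def by (intro bidual_diff bidual_tensor_bidual m0 n0 m(1) n(1))
      show "M \<Phi> = 0" by (simp add: \<Phi> M_val[OF \<phi> \<psi>] m(2) n(2))
      fix \<Psi> :: "('a, 'b) projective_tensor \<Rightarrow> complex" assume \<Psi>: "\<Psi> \<in> characters - {\<Phi>}"
      then obtain \<alpha> \<beta> where *: "\<alpha> \<in> characters" "\<beta> \<in> characters" "\<Psi> = tensor_functional \<alpha> \<beta>"
        using tensor_character_factors by blast
      with \<Psi> have "\<alpha> \<noteq> \<phi> \<or> \<beta> \<noteq> \<psi>" by (auto simp: \<Phi>)
      then have "m \<alpha> = 1 \<or> n \<beta> = 1" using m(3) n(3) * by blast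
      then show "M \<Psi> = 1" by (auto simp: *(3) M_val[OF *(1,2)])
    qed
  qed
qed

section \<open>From the product to the factors\<close>

lemma Delta_weak_character_amenable_left_factor:
  assumes T: "Delta_weak_character_amenable TYPE(('a::complex_banach_algebra, 'b::complex_banach_algebra) projective_tensor)"
    and \<psi>: "(\<psi> :: 'b \<Rightarrow> complex) \<in> characters"
  shows "Delta_weak_character_amenable TYPE('a)"
proof (rule Delta_weak_character_amenable_pullback[OF T, where J = "\<lambda>f. tensor_functional f \<psi>" and L = "onorm \<psi>"])
  note d = characters_in_dual[OF \<psi>]
  fix f g :: "'a \<Rightarrow> complex" and c assume f: "f \<in> dual"
  show "tensor_functional f \<psi> \<in> dual" by (intro tensor_functional_dual f d)
  show "onorm (tensor_functional f \<psi>) \<le> onorm \<psi> * onorm f"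
    using onorm_tensor_functional_le[OF f d] by (simp add: mult.commute)
  show "tensor_functional (\<lambda>x. c * f x) \<psi> = (\<lambda>u. c * tensor_functional f \<psi> u)"
    by (rule tensor_dual_eqI)
      (simp_all add: tensor_functional_dual tensor_functional_elem dual_scale f d)
  assume g: "g \<in> dual"
  show "tensor_functional (\<lambda>x. f x + g x) \<psi> = (\<lambda>u. tensor_functional f \<psi> u + tensor_functional g \<psi> u)"
    by (rule tensor_dual_eqI)
      (simp_all add: tensor_functional_dual tensor_functional_elem dual_add f g d distrib_right)
next
  \<comment> \<open>Evaluation at \<open>a \<otimes> b\<close> recovers \<open>\<alpha> a\<close>
    from \<open>\<alpha> \<otimes> \<psi>\<close> upon division by \<open>\<psi> b\<close>.\<close>
  obtain b where b: "\<psi> b \<noteq> 0" using character_nonzero[OF \<psi>] .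
  show "inj_on (\<lambda>f. tensor_functional f \<psi>) (characters :: ('a \<Rightarrow> complex) set)"
  proof (rule inj_onI, rule ext)
    fix \<alpha> \<beta> :: "'a \<Rightarrow> complex" and a
    assume \<alpha>: "\<alpha> \<in> characters" and \<beta>: "\<beta> \<in> characters" and "tensor_functional \<alpha> \<psi> = tensor_functional \<beta> \<psi>"
    then have "tensor_functional \<alpha> \<psi> (a \<otimes> b) = tensor_functional \<beta> \<psi> (a \<otimes> b)" by simp
    then show "\<alpha> a = \<beta> a" using b by (simp add: tensor_functional_elem characters_in_dual \<alpha> \<beta> \<psi>)
  qed
qed (rule tensor_functional_character[OF _ \<psi>])

lemma Delta_weak_character_amenable_right_factor:
  assumes T: "Delta_weak_character_amenable TYPE(('a::complex_banach_algebra, 'b::complex_banach_algebra) projective_tensor)"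
    and \<phi>: "(\<phi> :: 'a \<Rightarrow> complex) \<in> characters"
  shows "Delta_weak_character_amenable TYPE('b)"
proof (rule Delta_weak_character_amenable_pullback[OF T, where J = "tensor_functional \<phi>" and L = "onorm \<phi>"])
  note d = characters_in_dual[OF \<phi>]
  fix f g :: "'b \<Rightarrow> complex" and c assume f: "f \<in> dual"
  show "tensor_functional \<phi> f \<in> dual" by (intro tensor_functional_dual f d)
  show "onorm (tensor_functional \<phi> f) \<le> onorm \<phi> * onorm f" by (rule onorm_tensor_functional_le[OF d f])
  show "tensor_functional \<phi> (\<lambda>x. c * f x) = (\<lambda>u. c * tensor_functional \<phi> f u)"
    by (rule tensor_dual_eqI)
      (simp_all add: tensor_functional_dual tensor_functional_elem dual_scale f d)
  assume g: "g \<in> dual"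
  show "tensor_functional \<phi> (\<lambda>x. f x + g x) = (\<lambda>u. tensor_functional \<phi> f u + tensor_functional \<phi> g u)"
    by (rule tensor_dual_eqI)
      (simp_all add: tensor_functional_dual tensor_functional_elem dual_add f g d distrib_left)
next
  obtain a where a: "\<phi> a \<noteq> 0" using character_nonzero[OF \<phi>] .
  show "inj_on (tensor_functional \<phi>) (characters :: ('b \<Rightarrow> complex) set)"
  proof (rule inj_onI, rule ext)
    fix \<alpha> \<beta> :: "'b \<Rightarrow> complex" and b
    assume \<alpha>: "\<alpha> \<in> characters" and \<beta>: "\<beta> \<in> characters" and "tensor_functional \<phi> \<alpha> = tensor_functional \<phi> \<beta>"
    then have "tensor_functional \<phi> \<alpha> (a \<otimes> b) = tensor_functional \<phi> \<beta> (a \<otimes> b)" by simp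
    then show "\<alpha> b = \<beta> b" using a by (simp add: tensor_functional_elem characters_in_dual \<alpha> \<beta> \<phi>)
  qed
qed (rule tensor_functional_character[OF \<phi>])

text \<open>Only the zero functional is left to test, with no condition at characters, so the zero
  element of the bidual is a witness.\<close>

lemma Delta_weak_character_amenable_no_characters:
  assumes "(characters :: ('a::complex_banach_algebra \<Rightarrow> complex) set) = {}"
  shows "Delta_weak_character_amenable TYPE('a)"
proof -
  have "(\<lambda>_. 0) \<in> (bidual :: (('a \<Rightarrow> complex) \<Rightarrow> complex) set)" by (rule bidualI[of _ 0]) auto
  then have "Delta_weak_amenable (\<lambda>_ :: 'a. 0)"
    unfolding Delta_weak_amenable_iff assms by (intro bexI[of _ "\<lambda>_. 0"]) auto
  then show ?thesis by (simp add: Delta_weak_character_amenable_def assms)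
qed

text \<open>If exactly one factor has characters, the product has none and is amenable for that
  reason alone, which gives no information on the factor with characters. The equivalence is
  therefore stated for character sets that are both empty or both nonempty; the implication from the
  factors to the product is unconditional.\<close>

theorem corollary2p8:
  shows "(Delta_weak_character_amenable TYPE('a::complex_banach_algebra) \<and>
          Delta_weak_character_amenable TYPE('b::complex_banach_algebra) \<longrightarrow>
          Delta_weak_character_amenable TYPE(('a, 'b) projective_tensor)) \<and>
         (((characters :: ('a \<Rightarrow> complex) set) = {} \<longleftrightarrow> (characters :: ('b \<Rightarrow> complex) set) = {}) \<longrightarrow>
          (Delta_weak_character_amenable TYPE(('a, 'b) projective_tensor) \<longleftrightarrow>
           Delta_weak_character_amenable TYPE('a) \<and> Delta_weak_character_amenable TYPE('b)))"
proof (intro conjI impI iffI)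
  assume "Delta_weak_character_amenable TYPE('a) \<and> Delta_weak_character_amenable TYPE('b)"
  then show "Delta_weak_character_amenable TYPE(('a, 'b) projective_tensor)"
    and "Delta_weak_character_amenable TYPE(('a, 'b) projective_tensor)"
    by (simp_all add: Delta_weak_character_amenable_tensor)
next
  assume iff: "(characters :: ('a \<Rightarrow> complex) set) = {} \<longleftrightarrow> (characters :: ('b \<Rightarrow> complex) set) = {}"
    and T: "Delta_weak_character_amenable TYPE(('a, 'b) projective_tensor)"
  show "Delta_weak_character_amenable TYPE('a)"
    \<comment> \<open>Either the factor has no characters, or the other factor has one to be held
      fixed in the pullback.\<close>
    using iff Delta_weak_character_amenable_no_characters Delta_weak_character_amenable_left_factor[OF T] by blast
  show "Delta_weak_character_amenable TYPE('b)"
    using iff Delta_weak_character_amenable_no_characters Delta_weak_character_amenable_right_factor[OF T] by blast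
qed

end
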